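(* Let $\mathbf{B},\mathbf{C},\mathbf{D}$ be complete and cocomplete categories, where $\mathbf{C}$ admits a cogenerating set and is well-powered. Let $F:\mathbf{B}\to\mathbf{C}$, $G:\mathbf{C}\to\mathbf{B}$, $L:\mathbf{C}\to\mathbf{D}$ and $S,R:\mathbf{D}\to\mathbf{C}$ be functors with $F\dashv G$ and $S\dashv L\dashv R$. Assume further that both $G$ and $L$ are faithful, and that at least one of the two is conservative. Then $\mathbf{C}$ is a reflective subcategory of $(\mathbf{B}\downarrow(G\circ R))\cong(F\downarrow R)\cong((L\circ F)\downarrow\mathbf{D})$, embedded by the functor $\gamma:\mathbf{C}\to(F\downarrow R)$ given by $$\gamma(A):=\eta^{L\dashv R}_A\circ\varepsilon^{F\dashv G}_A : F(G(A))\to R(L(A)),\qquad \gamma(f):=(G(f)\downarrow L(f)),$$ for $A$ and $f$ respectively an object and an arrow of $\mathbf{C}$. That is, $\gamma$ is full and faithful and has a left adjoint.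
   Context: For functors $P:\mathbf{X}\to\mathbf{Z}$ and $Q:\mathbf{Y}\to\mathbf{Z}$, the comma category $(P\downarrow Q)$ has as objects triples $(X,Y,h)$ with $X\in\mathbf{X}$, $Y\in\mathbf{Y}$ and $h:P(X)\to Q(Y)$ in $\mathbf{Z}$. A morphism $(X,Y,h)\to(X',Y',h')$ is a pair, written $(a\downarrow b)$, of arrows $a:X\to X'$ and $b:Y\to Y'$ with $h'\circ P(a)=Q(b)\circ h$. When a category is written in place of a functor, as in $(\mathbf{B}\downarrow(G\circ R))$ or $((L\circ F)\downarrow\mathbf{D})$, it stands for its identity functor. The equivalences between the three comma categories are those given by adjoint transposition along $F\dashv G$ and $L\dashv R$. $\varepsilon^{F\dashv G}:F\circ G\to\mathrm{id}_{\mathbf{C}}$ denotes the counit of $F\dashv G$, and $\eta^{L\dashv R}:\mathrm{id}_{\mathbf{C}}\to R\circ L$ denotes the unit of $L\dashv R$. The object $\gamma(A)$ of $(F\downarrow R)$ is the triple $(G(A),L(A),\eta^{L\dashv R}_A\circ\varepsilon^{F\dashv G}_A)$. A functor is conservative if it reflects isomorphisms. A category is well-powered if every object has only a set of subobjects. A reflective subcategory is a full subcategory (up to equivalence) whose embedding has a left adjoint. *)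

theory Defs
  imports Main
begin

unbundle cardinal_syntax

record ('o, 'a) cat =
  Obj :: "'o set"
  Arr :: "'a set"
  Dom :: "'a \<Rightarrow> 'o"
  Cod :: "'a \<Rightarrow> 'o"
  Id :: "'o \<Rightarrow> 'a"
  Comp :: "'a \<Rightarrow> 'a \<Rightarrow> 'a"  (infixr \<open>\<odot>\<index>\<close> 70)

definition hom :: "('o, 'a) cat \<Rightarrow> 'o \<Rightarrow> 'o \<Rightarrow> 'a set" where
  "hom C X Y = {f \<in> Arr C. Dom C f = X \<and> Cod C f = Y}"

locale category =
  fixes C :: "('o, 'a) cat" (structure)
  assumes dom_in: "f \<in> Arr C \<Longrightarrow> Dom C f \<in> Obj C"
    and cod_in: "f \<in> Arr C \<Longrightarrow> Cod C f \<in> Obj C"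
    and id_in: "X \<in> Obj C \<Longrightarrow> Id C X \<in> hom C X X"
    and comp_in: "\<lbrakk>g \<in> hom C Y Z; f \<in> hom C X Y\<rbrakk> \<Longrightarrow> g \<odot> f \<in> hom C X Z"
    and id_left: "f \<in> hom C X Y \<Longrightarrow> Id C Y \<odot> f = f"
    and id_right: "f \<in> hom C X Y \<Longrightarrow> f \<odot> Id C X = f"
    and comp_assoc: "\<lbrakk>h \<in> hom C Y Z; g \<in> hom C X Y; f \<in> hom C W X\<rbrakk>
          \<Longrightarrow> (h \<odot> g) \<odot> f = h \<odot> (g \<odot> f)"

record ('o, 'a, 'p, 'b) ftor =
  FObj :: "'o \<Rightarrow> 'p"
  FArr :: "'a \<Rightarrow> 'b"

locale is_functor = A: category A + B: category B
  for A :: "('o, 'a) cat" and B :: "('p, 'b) cat" +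
  fixes F :: "('o, 'a, 'p, 'b) ftor"
  assumes obj_in: "X \<in> Obj A \<Longrightarrow> FObj F X \<in> Obj B"
    and arr_in: "f \<in> hom A X Y \<Longrightarrow> FArr F f \<in> hom B (FObj F X) (FObj F Y)"
    and pres_id: "X \<in> Obj A \<Longrightarrow> FArr F (Id A X) = Id B (FObj F X)"
    and pres_comp: "\<lbrakk>g \<in> hom A Y Z; f \<in> hom A X Y\<rbrakk>
          \<Longrightarrow> FArr F (g \<odot>\<^bsub>A\<^esub> f) = FArr F g \<odot>\<^bsub>B\<^esub> FArr F f"

definition id_ftor :: "('o, 'a, 'o, 'a) ftor" where
  "id_ftor = \<lparr>FObj = (\<lambda>X. X), FArr = (\<lambda>f. f)\<rparr>"

definition comp_ftor ::
    "('p, 'b, 'q, 'c) ftor \<Rightarrow> ('o, 'a, 'p, 'b) ftor \<Rightarrow> ('o, 'a, 'q, 'c) ftor" where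
  "comp_ftor G F = \<lparr>FObj = FObj G \<circ> FObj F, FArr = FArr G \<circ> FArr F\<rparr>"

locale nat_trans = F: is_functor A B F + G: is_functor A B G
  for A :: "('o, 'a) cat" and B :: "('p, 'b) cat"
    and F :: "('o, 'a, 'p, 'b) ftor" and G :: "('o, 'a, 'p, 'b) ftor" +
  fixes \<tau> :: "'o \<Rightarrow> 'b"
  assumes component_in: "X \<in> Obj A \<Longrightarrow> \<tau> X \<in> hom B (FObj F X) (FObj G X)"
    and naturality: "f \<in> hom A X Y \<Longrightarrow> \<tau> Y \<odot>\<^bsub>B\<^esub> FArr F f = FArr G f \<odot>\<^bsub>B\<^esub> \<tau> X"

locale adjunction =
  unit: nat_trans A A id_ftor "comp_ftor G F" \<eta> +
  counit: nat_trans B B "comp_ftor F G" id_ftor \<epsilon> +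
  left: is_functor A B F +
  right: is_functor B A G
  for A :: "('o, 'a) cat" and B :: "('p, 'b) cat"
    and F :: "('o, 'a, 'p, 'b) ftor" and G :: "('p, 'b, 'o, 'a) ftor"
    and \<eta> :: "'o \<Rightarrow> 'a" and \<epsilon> :: "'p \<Rightarrow> 'b" +
  assumes triangle_left: "X \<in> Obj A \<Longrightarrow> \<epsilon> (FObj F X) \<odot>\<^bsub>B\<^esub> FArr F (\<eta> X) = Id B (FObj F X)"
    and triangle_right: "Y \<in> Obj B \<Longrightarrow> FArr G (\<epsilon> Y) \<odot>\<^bsub>A\<^esub> \<eta> (FObj G Y) = Id A (FObj G Y)"

definition has_left_adjoint ::
    "('p, 'b) cat \<Rightarrow> ('o, 'a) cat \<Rightarrow> ('p, 'b, 'o, 'a) ftor \<Rightarrow> bool" where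
  "has_left_adjoint B A G \<longleftrightarrow> (\<exists>F \<eta> \<epsilon>. adjunction A B F G \<eta> \<epsilon>)"

definition iso_arr :: "('o, 'a) cat \<Rightarrow> 'a \<Rightarrow> bool" where
  "iso_arr C f \<longleftrightarrow> (\<exists>X Y g. f \<in> hom C X Y \<and> g \<in> hom C Y X \<and>
     g \<odot>\<^bsub>C\<^esub> f = Id C X \<and> f \<odot>\<^bsub>C\<^esub> g = Id C Y)"

definition faithful ::
    "('o, 'a) cat \<Rightarrow> ('o, 'a, 'p, 'b) ftor \<Rightarrow> bool" where
  "faithful A F \<longleftrightarrow> (\<forall>X\<in>Obj A. \<forall>Y\<in>Obj A. inj_on (FArr F) (hom A X Y))"

definition full ::
    "('o, 'a) cat \<Rightarrow> ('p, 'b) cat \<Rightarrow> ('o, 'a, 'p, 'b) ftor \<Rightarrow> bool" where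
  "full A B F \<longleftrightarrow> (\<forall>X\<in>Obj A. \<forall>Y\<in>Obj A.
     hom B (FObj F X) (FObj F Y) \<subseteq> FArr F ` hom A X Y)"

definition conservative ::
    "('o, 'a) cat \<Rightarrow> ('p, 'b) cat \<Rightarrow> ('o, 'a, 'p, 'b) ftor \<Rightarrow> bool" where
  "conservative A B F \<longleftrightarrow> (\<forall>f\<in>Arr A. iso_arr B (FArr F f) \<longrightarrow> iso_arr A f)"

definition reflective_embedding ::
    "('o, 'a) cat \<Rightarrow> ('p, 'b) cat \<Rightarrow> ('o, 'a, 'p, 'b) ftor \<Rightarrow> bool" where
  "reflective_embedding A B I \<longleftrightarrow>
     is_functor A B I \<and> full A B I \<and> faithful A I \<and> has_left_adjoint A B I"

definition cat_isomorphism ::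
    "('o, 'a) cat \<Rightarrow> ('p, 'b) cat \<Rightarrow> ('o, 'a, 'p, 'b) ftor \<Rightarrow> bool" where
  "cat_isomorphism A B T \<longleftrightarrow> is_functor A B T \<and> (\<exists>K. is_functor B A K \<and>
     (\<forall>X\<in>Obj A. FObj K (FObj T X) = X) \<and> (\<forall>f\<in>Arr A. FArr K (FArr T f) = f) \<and>
     (\<forall>Y\<in>Obj B. FObj T (FObj K Y) = Y) \<and> (\<forall>g\<in>Arr B. FArr T (FArr K g) = g))"

text \<open>
  ``Set'' (as opposed to class) means cardinality below a fixed infinite regular cardinal
  \<open>\<kappa>\<close>, which is a parameter. Taking \<open>\<kappa>\<close> strongly inaccessible gives the small sets of a
  Grothendieck universe.
\<close>

definition size_cardinal :: "'u rel \<Rightarrow> bool" where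
  "size_cardinal \<kappa> \<longleftrightarrow> Card_order \<kappa> \<and> cinfinite \<kappa> \<and> regularCard \<kappa>"

definition small :: "'u rel \<Rightarrow> 'x set \<Rightarrow> bool" where
  "small \<kappa> S \<longleftrightarrow> |S| <o \<kappa>"

definition locally_small :: "'u rel \<Rightarrow> ('o, 'a) cat \<Rightarrow> bool" where
  "locally_small \<kappa> C \<longleftrightarrow> (\<forall>X\<in>Obj C. \<forall>Y\<in>Obj C. small \<kappa> (hom C X Y))"

definition is_cone :: "('j, 'k) cat \<Rightarrow> ('o, 'a) cat \<Rightarrow> ('j, 'k, 'o, 'a) ftor
    \<Rightarrow> 'o \<Rightarrow> ('j \<Rightarrow> 'a) \<Rightarrow> bool" where
  "is_cone J C D X \<pi> \<longleftrightarrow> X \<in> Obj C \<and> (\<forall>j\<in>Obj J. \<pi> j \<in> hom C X (FObj D j)) \<and>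
     (\<forall>u\<in>Arr J. FArr D u \<odot>\<^bsub>C\<^esub> \<pi> (Dom J u) = \<pi> (Cod J u))"

definition is_limit :: "('j, 'k) cat \<Rightarrow> ('o, 'a) cat \<Rightarrow> ('j, 'k, 'o, 'a) ftor
    \<Rightarrow> 'o \<Rightarrow> ('j \<Rightarrow> 'a) \<Rightarrow> bool" where
  "is_limit J C D X \<pi> \<longleftrightarrow> is_cone J C D X \<pi> \<and>
     (\<forall>Y \<rho>. is_cone J C D Y \<rho> \<longrightarrow>
        (\<exists>!f. f \<in> hom C Y X \<and> (\<forall>j\<in>Obj J. \<pi> j \<odot>\<^bsub>C\<^esub> f = \<rho> j)))"

definition is_cocone :: "('j, 'k) cat \<Rightarrow> ('o, 'a) cat \<Rightarrow> ('j, 'k, 'o, 'a) ftor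
    \<Rightarrow> 'o \<Rightarrow> ('j \<Rightarrow> 'a) \<Rightarrow> bool" where
  "is_cocone J C D X \<iota> \<longleftrightarrow> X \<in> Obj C \<and> (\<forall>j\<in>Obj J. \<iota> j \<in> hom C (FObj D j) X) \<and>
     (\<forall>u\<in>Arr J. \<iota> (Cod J u) \<odot>\<^bsub>C\<^esub> FArr D u = \<iota> (Dom J u))"

definition is_colimit :: "('j, 'k) cat \<Rightarrow> ('o, 'a) cat \<Rightarrow> ('j, 'k, 'o, 'a) ftor
    \<Rightarrow> 'o \<Rightarrow> ('j \<Rightarrow> 'a) \<Rightarrow> bool" where
  "is_colimit J C D X \<iota> \<longleftrightarrow> is_cocone J C D X \<iota> \<and>
     (\<forall>Y \<rho>. is_cocone J C D Y \<rho> \<longrightarrow>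
        (\<exists>!f. f \<in> hom C X Y \<and> (\<forall>j\<in>Obj J. f \<odot>\<^bsub>C\<^esub> \<iota> j = \<rho> j)))"

text \<open>
  Objects and arrows of the index categories are taken from the type \<open>'u\<close> on which \<open>\<kappa>\<close> lives.
  This is no restriction: a set of cardinality below \<open>\<kappa>\<close> injects into \<open>'u\<close>, so every small
  category has an isomorphic copy there. Smallness of the set of objects follows from that of
  the set of arrows, through the identities.
\<close>

definition complete_cat :: "'u rel \<Rightarrow> ('o, 'a) cat \<Rightarrow> bool" where
  "complete_cat \<kappa> C \<longleftrightarrow> (\<forall>(J :: ('u, 'u) cat) D.
     small \<kappa> (Arr J) \<and> is_functor J C D \<longrightarrow> (\<exists>X \<pi>. is_limit J C D X \<pi>))"

definition cocomplete_cat :: "'u rel \<Rightarrow> ('o, 'a) cat \<Rightarrow> bool" where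
  "cocomplete_cat \<kappa> C \<longleftrightarrow> (\<forall>(J :: ('u, 'u) cat) D.
     small \<kappa> (Arr J) \<and> is_functor J C D \<longrightarrow> (\<exists>X \<iota>. is_colimit J C D X \<iota>))"

definition cogenerating :: "('o, 'a) cat \<Rightarrow> 'o set \<Rightarrow> bool" where
  "cogenerating C Q \<longleftrightarrow> Q \<subseteq> Obj C \<and>
     (\<forall>X Y. \<forall>f\<in>hom C X Y. \<forall>g\<in>hom C X Y. f \<noteq> g \<longrightarrow>
        (\<exists>q\<in>Q. \<exists>h\<in>hom C Y q. h \<odot>\<^bsub>C\<^esub> f \<noteq> h \<odot>\<^bsub>C\<^esub> g))"

definition mono_arr :: "('o, 'a) cat \<Rightarrow> 'a \<Rightarrow> bool" where
  "mono_arr C m \<longleftrightarrow> m \<in> Arr C \<and>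
     (\<forall>W. \<forall>f\<in>hom C W (Dom C m). \<forall>g\<in>hom C W (Dom C m).
        m \<odot>\<^bsub>C\<^esub> f = m \<odot>\<^bsub>C\<^esub> g \<longrightarrow> f = g)"

definition monos_into :: "('o, 'a) cat \<Rightarrow> 'o \<Rightarrow> 'a set" where
  "monos_into C X = {m. mono_arr C m \<and> Cod C m = X}"

definition sub_equiv :: "('o, 'a) cat \<Rightarrow> 'o \<Rightarrow> ('a \<times> 'a) set" where
  "sub_equiv C X = {(m, n). m \<in> monos_into C X \<and> n \<in> monos_into C X \<and>
     (\<exists>i\<in>hom C (Dom C m) (Dom C n). iso_arr C i \<and> n \<odot>\<^bsub>C\<^esub> i = m)}"

definition subobjects :: "('o, 'a) cat \<Rightarrow> 'o \<Rightarrow> 'a set set" where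
  "subobjects C X = monos_into C X // sub_equiv C X"

definition well_powered :: "'u rel \<Rightarrow> ('o, 'a) cat \<Rightarrow> bool" where
  "well_powered \<kappa> C \<longleftrightarrow> (\<forall>X\<in>Obj C. small \<kappa> (subobjects C X))"

text \<open>
  The pair \<open>(a, b)\<close> does not determine its source and target, so an arrow
  carries them along as its first two components.
\<close>

type_synonym ('ox, 'oy, 'az) comma_obj = "'ox \<times> 'oy \<times> 'az"
type_synonym ('ox, 'ax, 'oy, 'ay, 'az) comma_arr =
  "('ox, 'oy, 'az) comma_obj \<times> ('ox, 'oy, 'az) comma_obj \<times> ('ax \<times> 'ay)"

definition comma_objs :: "('ox, 'ax) cat \<Rightarrow> ('oy, 'ay) cat \<Rightarrow> ('oz, 'az) cat
    \<Rightarrow> ('ox, 'ax, 'oz, 'az) ftor \<Rightarrow> ('oy, 'ay, 'oz, 'az) ftor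
    \<Rightarrow> ('ox, 'oy, 'az) comma_obj set" where
  "comma_objs \<X> \<Y> \<Z> P Q =
     {(X, Y, h). X \<in> Obj \<X> \<and> Y \<in> Obj \<Y> \<and> h \<in> hom \<Z> (FObj P X) (FObj Q Y)}"

definition comma_arrs :: "('ox, 'ax) cat \<Rightarrow> ('oy, 'ay) cat \<Rightarrow> ('oz, 'az) cat
    \<Rightarrow> ('ox, 'ax, 'oz, 'az) ftor \<Rightarrow> ('oy, 'ay, 'oz, 'az) ftor
    \<Rightarrow> ('ox, 'ax, 'oy, 'ay, 'az) comma_arr set" where
  "comma_arrs \<X> \<Y> \<Z> P Q =
     {((X, Y, h), (X', Y', h'), (a, b)).
        (X, Y, h) \<in> comma_objs \<X> \<Y> \<Z> P Q \<and> (X', Y', h') \<in> comma_objs \<X> \<Y> \<Z> P Q \<and>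
        a \<in> hom \<X> X X' \<and> b \<in> hom \<Y> Y Y' \<and>
        h' \<odot>\<^bsub>\<Z>\<^esub> FArr P a = FArr Q b \<odot>\<^bsub>\<Z>\<^esub> h}"

definition comma :: "('ox, 'ax) cat \<Rightarrow> ('oy, 'ay) cat \<Rightarrow> ('oz, 'az) cat
    \<Rightarrow> ('ox, 'ax, 'oz, 'az) ftor \<Rightarrow> ('oy, 'ay, 'oz, 'az) ftor
    \<Rightarrow> (('ox, 'oy, 'az) comma_obj, ('ox, 'ax, 'oy, 'ay, 'az) comma_arr) cat" where
  "comma \<X> \<Y> \<Z> P Q =
     \<lparr>Obj = comma_objs \<X> \<Y> \<Z> P Q,
      Arr = comma_arrs \<X> \<Y> \<Z> P Q,
      Dom = (\<lambda>(s, t, a, b). s),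
      Cod = (\<lambda>(s, t, a, b). t),
      Id = (\<lambda>(X, Y, h). ((X, Y, h), (X, Y, h), (Id \<X> X, Id \<Y> Y))),
      Comp = (\<lambda>(s', t', a', b') (s, t, a, b). (s, t', (a' \<odot>\<^bsub>\<X>\<^esub> a, b' \<odot>\<^bsub>\<Y>\<^esub> b)))\<rparr>"

text \<open>
  The functors \<open>(F \<down> R) \<rightarrow> (B \<down> (G \<circ> R))\<close> and \<open>(F \<down> R) \<rightarrow> ((L \<circ> F) \<down> D)\<close> replacing
  \<open>h : F X \<rightarrow> R Y\<close> by its transpose \<open>X \<rightarrow> G (R Y)\<close> along \<open>F \<stileturn> G\<close>, respectively
  \<open>L (F X) \<rightarrow> Y\<close> along \<open>L \<stileturn> R\<close>, and leaving the pairs of arrows unchanged.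
\<close>

definition on_structure_map :: "('ox \<Rightarrow> 'oy \<Rightarrow> 'az \<Rightarrow> 'aw)
    \<Rightarrow> (('ox, 'oy, 'az) comma_obj, ('ox, 'ax, 'oy, 'ay, 'az) comma_arr,
        ('ox, 'oy, 'aw) comma_obj, ('ox, 'ax, 'oy, 'ay, 'aw) comma_arr) ftor" where
  "on_structure_map t =
     (let T = (\<lambda>(X, Y, h). (X, Y, t X Y h)) in
      \<lparr>FObj = T, FArr = (\<lambda>(p, q, a, b). (T p, T q, (a, b)))\<rparr>)"

definition transpose_FG :: "('ob, 'ab) cat \<Rightarrow> ('oc, 'ac, 'ob, 'ab) ftor \<Rightarrow> ('ob \<Rightarrow> 'ab)
    \<Rightarrow> (('ob, 'od, 'ac) comma_obj, ('ob, 'ab, 'od, 'ad, 'ac) comma_arr,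
        ('ob, 'od, 'ab) comma_obj, ('ob, 'ab, 'od, 'ad, 'ab) comma_arr) ftor" where
  "transpose_FG B G \<eta> = on_structure_map (\<lambda>X Y h. FArr G h \<odot>\<^bsub>B\<^esub> \<eta> X)"

definition transpose_LR :: "('od, 'ad) cat \<Rightarrow> ('oc, 'ac, 'od, 'ad) ftor \<Rightarrow> ('od \<Rightarrow> 'ad)
    \<Rightarrow> (('ob, 'od, 'ac) comma_obj, ('ob, 'ab, 'od, 'ad, 'ac) comma_arr,
        ('ob, 'od, 'ad) comma_obj, ('ob, 'ab, 'od, 'ad, 'ad) comma_arr) ftor" where
  "transpose_LR D L \<epsilon> = on_structure_map (\<lambda>X Y h. \<epsilon> Y \<odot>\<^bsub>D\<^esub> FArr L h)"

definition gamma_obj :: "('oc, 'ac) cat \<Rightarrow> ('oc, 'ac, 'ob, 'ab) ftor \<Rightarrow> ('oc, 'ac, 'od, 'ad) ftor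
    \<Rightarrow> ('oc \<Rightarrow> 'ac) \<Rightarrow> ('oc \<Rightarrow> 'ac) \<Rightarrow> 'oc \<Rightarrow> ('ob, 'od, 'ac) comma_obj" where
  "gamma_obj C G L \<epsilon> \<eta> A = (FObj G A, FObj L A, \<eta> A \<odot>\<^bsub>C\<^esub> \<epsilon> A)"

definition gamma :: "('oc, 'ac) cat \<Rightarrow> ('oc, 'ac, 'ob, 'ab) ftor \<Rightarrow> ('oc, 'ac, 'od, 'ad) ftor
    \<Rightarrow> ('oc \<Rightarrow> 'ac) \<Rightarrow> ('oc \<Rightarrow> 'ac)
    \<Rightarrow> ('oc, 'ac, ('ob, 'od, 'ac) comma_obj, ('ob, 'ab, 'od, 'ad, 'ac) comma_arr) ftor" where
  "gamma C G L \<epsilon> \<eta> =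
     \<lparr>FObj = gamma_obj C G L \<epsilon> \<eta>,
      FArr = (\<lambda>f. (gamma_obj C G L \<epsilon> \<eta> (Dom C f), gamma_obj C G L \<epsilon> \<eta> (Cod C f),
                    (FArr G f, FArr L f)))\<rparr>"

end

theory Submission
  imports Defs
begin

text \<open>
  For an object \<open>(X, Y, h)\<close> of \<open>(F \<down> R)\<close>, transposing along the three adjunctions turns a morphism
  \<open>(X, Y, h) \<rightarrow> \<gamma> A\<close> into a pair of arrows \<open>F X \<rightarrow> A\<close> and \<open>S Y \<rightarrow> A\<close> that agree on \<open>S (L (F X))\<close>, so
  the reflection is a pushout in \<open>C\<close>. For fullness, transposing a morphism \<open>\<gamma> A \<rightarrow> \<gamma> A'\<close> gives a
  square from the counit of \<open>F \<stileturn> G\<close> at \<open>A\<close>, which is epi as \<open>G\<close> is faithful, to the unit of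
  \<open>L \<stileturn> R\<close> at \<open>A'\<close>, which is mono as \<open>L\<close> is faithful. The square has a diagonal: if \<open>G\<close> is
  conservative, the pullback of the mono along the other side receives the counit, so \<open>G\<close> sends its
  projection to a split epi which is mono, hence this projection is invertible; the case of \<open>L\<close> is
  dual.
\<close>

lemma (in category) hom_objs: "f \<in> hom C X Y \<Longrightarrow> X \<in> Obj C \<and> Y \<in> Obj C"
  using dom_in cod_in by (auto simp: hom_def)

subsection \<open>Opposite categories\<close>

text \<open>Dualisation keeps the types of objects and arrows and reuses the same functor records.
  The dual of a lemma is therefore an instance of it, and pushouts and epimorphisms are pullbacks
  and monomorphisms of \<open>op_cat C\<close>.\<close>

definition op_cat :: "('o, 'a) cat \<Rightarrow> ('o, 'a) cat" where
  "op_cat C = \<lparr>Obj = Obj C, Arr = Arr C, Dom = Cod C, Cod = Dom C, Id = Id C,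
     Comp = (\<lambda>g f. f \<odot>\<^bsub>C\<^esub> g)\<rparr>"

lemma op_cat_simps [simp]:
  "Obj (op_cat C) = Obj C" "Arr (op_cat C) = Arr C" "Dom (op_cat C) = Cod C"
  "Cod (op_cat C) = Dom C" "Id (op_cat C) = Id C" "g \<odot>\<^bsub>op_cat C\<^esub> f = f \<odot>\<^bsub>C\<^esub> g"
  by (simp_all add: op_cat_def)

lemma op_cat_op_cat [simp]: "op_cat (op_cat C) = C"
  by (cases C) (simp add: op_cat_def)

lemma hom_op_cat [simp]: "hom (op_cat C) X Y = hom C Y X"
  by (auto simp: hom_def)

lemma category_op_cat: "category C \<Longrightarrow> category (op_cat C)"
  unfolding category_def by (simp, blast)

lemma is_functor_op_cat: "is_functor A B F \<Longrightarrow> is_functor (op_cat A) (op_cat B) F"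
  unfolding is_functor_def is_functor_axioms_def by (simp add: category_op_cat)

lemma nat_trans_op_cat:
  "nat_trans A B F G \<tau> \<Longrightarrow> nat_trans (op_cat A) (op_cat B) G F \<tau>"
  unfolding nat_trans_def nat_trans_axioms_def by (simp add: is_functor_op_cat)

text \<open>Reversing arrows makes the right adjoint the left one, so unit and counit change places,
  and so do the two triangle identities.\<close>

lemma adjunction_op_cat:
  "adjunction A B F G \<eta> \<epsilon> \<Longrightarrow> adjunction (op_cat B) (op_cat A) G F \<epsilon> \<eta>"
  unfolding adjunction_def adjunction_axioms_def
  by (simp add: is_functor_op_cat nat_trans_op_cat)

lemma iso_arr_op_cat [simp]: "iso_arr (op_cat C) f = iso_arr C f"
  unfolding iso_arr_def by auto

lemma faithful_op_cat [simp]: "faithful (op_cat A) F = faithful A F"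
  unfolding faithful_def by auto

lemma conservative_op_cat [simp]: "conservative (op_cat A) (op_cat B) F = conservative A B F"
  unfolding conservative_def by simp

lemma is_limit_op_cat:
  "is_limit (op_cat J) (op_cat C) D X \<pi> = is_colimit J C D X \<pi>"
  unfolding is_limit_def is_colimit_def is_cone_def is_cocone_def by simp

text \<open>A diagram of shape \<open>J\<close> in \<open>op_cat C\<close> is a diagram of shape
  \<open>op_cat J\<close> in \<open>C\<close>. The index type and the set of arrows stay the same,
  so smallness carries over.\<close>

lemma complete_cat_op_cat:
  fixes \<kappa> :: "'u rel" and C :: "('o, 'a) cat"
  assumes "cocomplete_cat \<kappa> C"
  shows "complete_cat \<kappa> (op_cat C)"
  unfolding complete_cat_def
proof (intro allI impI)
  fix J :: "('u, 'u) cat" and D :: "('u, 'u, 'o, 'a) ftor"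
  assume "small \<kappa> (Arr J) \<and> is_functor J (op_cat C) D"
  then have "small \<kappa> (Arr (op_cat J)) \<and> is_functor (op_cat J) C D"
    using is_functor_op_cat[of J "op_cat C" D] by simp
  then obtain X \<pi> where "is_colimit (op_cat J) C D X \<pi>"
    using assms unfolding cocomplete_cat_def by blast
  then have "is_limit J (op_cat C) D X \<pi>"
    using is_limit_op_cat[of "op_cat J" C D X \<pi>] by simp
  then show "\<exists>X \<pi>. is_limit J (op_cat C) D X \<pi>" by blast
qed

subsection \<open>Pullbacks\<close>

definition is_pullback :: "('o, 'a) cat \<Rightarrow> 'o \<Rightarrow> 'o \<Rightarrow> 'a \<Rightarrow> 'a \<Rightarrow> 'o \<Rightarrow> 'a \<Rightarrow> 'a \<Rightarrow> bool" where
  "is_pullback C X Y f g P p q \<longleftrightarrow> p \<in> hom C P X \<and> q \<in> hom C P Y \<and> f \<odot>\<^bsub>C\<^esub> p = g \<odot>\<^bsub>C\<^esub> q \<and>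
     (\<forall>W. \<forall>a\<in>hom C W X. \<forall>b\<in>hom C W Y. f \<odot>\<^bsub>C\<^esub> a = g \<odot>\<^bsub>C\<^esub> b \<longrightarrow>
        (\<exists>!d. d \<in> hom C W P \<and> p \<odot>\<^bsub>C\<^esub> d = a \<and> q \<odot>\<^bsub>C\<^esub> d = b))"

definition has_pullbacks :: "('o, 'a) cat \<Rightarrow> bool" where
  "has_pullbacks C \<longleftrightarrow> (\<forall>X Y Z. \<forall>f\<in>hom C X Z. \<forall>g\<in>hom C Y Z.
     \<exists>P p q. is_pullback C X Y f g P p q)"

lemma is_pullback_factor:
  assumes "is_pullback C X Y f g P p q" "a \<in> hom C W X" "b \<in> hom C W Y"
    and "f \<odot>\<^bsub>C\<^esub> a = g \<odot>\<^bsub>C\<^esub> b"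
  obtains d where "d \<in> hom C W P" "p \<odot>\<^bsub>C\<^esub> d = a" "q \<odot>\<^bsub>C\<^esub> d = b"
proof -
  have "\<exists>!d. d \<in> hom C W P \<and> p \<odot>\<^bsub>C\<^esub> d = a \<and> q \<odot>\<^bsub>C\<^esub> d = b"
    using assms unfolding is_pullback_def by simp
  then show ?thesis
    by (elim ex1E conjE) (rule that)
qed

text \<open>The projections are jointly monic: \<open>d\<close> and \<open>d'\<close> both factor
  the cone with legs \<open>p\<close> after \<open>d\<close> and \<open>q\<close> after
  \<open>d\<close>, which commutes because the pullback square does.\<close>

lemma (in category) is_pullback_cancel:
  assumes pb: "is_pullback C X Y f g P p q" and f: "f \<in> hom C X Z" and g: "g \<in> hom C Y Z"
    and d: "d \<in> hom C W P" and d': "d' \<in> hom C W P"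
    and eq: "p \<odot>\<^bsub>C\<^esub> d = p \<odot>\<^bsub>C\<^esub> d'" "q \<odot>\<^bsub>C\<^esub> d = q \<odot>\<^bsub>C\<^esub> d'"
  shows "d = d'"
proof -
  have p: "p \<in> hom C P X" and q: "q \<in> hom C P Y" and pq: "f \<odot>\<^bsub>C\<^esub> p = g \<odot>\<^bsub>C\<^esub> q"
    using pb unfolding is_pullback_def by simp_all
  have "f \<odot>\<^bsub>C\<^esub> (p \<odot>\<^bsub>C\<^esub> d) = g \<odot>\<^bsub>C\<^esub> (q \<odot>\<^bsub>C\<^esub> d)"
    using comp_assoc[OF f p d] comp_assoc[OF g q d] pq by simp
  then have "\<exists>!e. e \<in> hom C W P \<and> p \<odot>\<^bsub>C\<^esub> e = p \<odot>\<^bsub>C\<^esub> d \<and> q \<odot>\<^bsub>C\<^esub> e = q \<odot>\<^bsub>C\<^esub> d"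
    using pb comp_in[OF p d] comp_in[OF q d] unfolding is_pullback_def by simp
  then show ?thesis
    by (rule ex1E) (use d d' eq in metis)
qed

text \<open>Names for the five arrows of the shape of a cospan; the first three also name its
  objects.\<close>

datatype cospan = LObj | RObj | Vertex | LArr | RArr

text \<open>Completeness speaks only of index categories on the type \<open>'u\<close>, so the
  cospan shape has to be copied there. There is room because \<open>\<kappa>\<close> is
  infinite.\<close>

lemma complete_has_pullbacks:
  fixes \<kappa> :: "'u rel" and C :: "('o, 'a) cat"
  assumes size: "size_cardinal \<kappa>" and C: "category C" and compl: "complete_cat \<kappa> C"
  shows "has_pullbacks C"
  unfolding has_pullbacks_def
proof (intro allI ballI)
  fix X Y Z f g
  assume f: "f \<in> hom C X Z" and g: "g \<in> hom C Y Z"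
  interpret category C by fact
  have XYZ: "X \<in> Obj C" "Y \<in> Obj C" "Z \<in> Obj C"
    using f g hom_objs by blast+
  have inf: "infinite (Field \<kappa>)" and co: "Card_order \<kappa>"
    using size by (auto simp: size_cardinal_def cinfinite_def)
  obtain n :: "nat \<Rightarrow> 'u" where n: "inj n"
    using infinite_countable_subset[OF inf] by blast
  \<comment> \<open>An injective copy of the five names in \<open>'u\<close>; with the next fact the
    simplifier decides every test in the definitions of \<open>J\<close> and
    \<open>K\<close>.\<close>
  define e where "e = n \<circ> case_cospan 0 1 2 3 4"
  have e [simp]: "e i = e j \<longleftrightarrow> i = j" for i j
    by (cases i; cases j) (simp_all add: e_def inj_eq[OF n])
  \<comment> \<open>Every object of this index category is its own identity arrow.\<close>
  define J :: "('u, 'u) cat" where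
    "J = \<lparr>Obj = {e LObj, e RObj, e Vertex}, Arr = {e LObj, e RObj, e Vertex, e LArr, e RArr},
       Dom = (\<lambda>u. if u = e LArr then e LObj else if u = e RArr then e RObj else u),
       Cod = (\<lambda>u. if u = e LArr \<or> u = e RArr then e Vertex else u),
       Id = (\<lambda>u. u), Comp = (\<lambda>u v. if u \<in> {e LObj, e RObj, e Vertex} then v else u)\<rparr>"
  define K :: "('u, 'u, 'o, 'a) ftor" where
    "K = \<lparr>FObj = (\<lambda>u. if u = e LObj then X else if u = e RObj then Y else Z),
       FArr = (\<lambda>u. if u = e LObj then Id C X else if u = e RObj then Id C Y
                else if u = e Vertex then Id C Z else if u = e LArr then f else g)\<rparr>"
  have Obj_J: "Obj J = {e LObj, e RObj, e Vertex}" and Id_J: "Id J u = u" for u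
    by (simp_all add: J_def)
  have Arr_J: "u \<in> Arr J \<longleftrightarrow> u = e LObj \<or> u = e RObj \<or> u = e Vertex \<or> u = e LArr \<or> u = e RArr" for u
    by (simp add: J_def)
  have J_simps: "Dom J (e LObj) = e LObj" "Dom J (e RObj) = e RObj" "Dom J (e Vertex) = e Vertex"
    "Dom J (e LArr) = e LObj" "Dom J (e RArr) = e RObj"
    "Cod J (e LObj) = e LObj" "Cod J (e RObj) = e RObj" "Cod J (e Vertex) = e Vertex"
    "Cod J (e LArr) = e Vertex" "Cod J (e RArr) = e Vertex"
    "e LObj \<odot>\<^bsub>J\<^esub> v = v" "e RObj \<odot>\<^bsub>J\<^esub> v = v" "e Vertex \<odot>\<^bsub>J\<^esub> v = v"
    "e LArr \<odot>\<^bsub>J\<^esub> v = e LArr" "e RArr \<odot>\<^bsub>J\<^esub> v = e RArr" for v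
    by (simp_all add: J_def)
  have K_simps: "FObj K (e LObj) = X" "FObj K (e RObj) = Y" "FObj K (e Vertex) = Z"
    "FArr K (e LObj) = Id C X" "FArr K (e RObj) = Id C Y" "FArr K (e Vertex) = Id C Z"
    "FArr K (e LArr) = f" "FArr K (e RArr) = g"
    by (simp_all add: K_def)
  have hom_J: "u \<in> hom J i j \<longleftrightarrow>
      u = e LObj \<and> i = e LObj \<and> j = e LObj \<or> u = e RObj \<and> i = e RObj \<and> j = e RObj \<or>
      u = e Vertex \<and> i = e Vertex \<and> j = e Vertex \<or> u = e LArr \<and> i = e LObj \<and> j = e Vertex \<or>
      u = e RArr \<and> i = e RObj \<and> j = e Vertex" for u i j
  proof -
    have "u \<in> hom J i j \<longleftrightarrow> u \<in> Arr J \<and> i = Dom J u \<and> j = Cod J u"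
      unfolding hom_def by blast
    then show ?thesis
      by (simp only: Arr_J conj_disj_distribR J_simps disj_assoc conj_assoc cong: conj_cong)
  qed
  have J: "category J"
  proof
    show "w \<odot>\<^bsub>J\<^esub> v \<in> hom J i k" if "w \<in> hom J j k" "v \<in> hom J i j" for v w i j k
      using that unfolding hom_J by (auto simp: J_simps)
    \<comment> \<open>This holds for all elements, composable or not: composition returns its right
      argument if the left one is an identity, and its left argument otherwise.\<close>
    show "(w \<odot>\<^bsub>J\<^esub> v) \<odot>\<^bsub>J\<^esub> u = w \<odot>\<^bsub>J\<^esub> (v \<odot>\<^bsub>J\<^esub> u)" for u v w
      by (simp add: J_def)
  qed (auto simp: hom_J Arr_J Obj_J Id_J J_simps)
  have "is_functor J C K"
  proof (intro is_functor.intro is_functor_axioms.intro J C)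
    show "FArr K u \<in> hom C (FObj K i) (FObj K j)" if "u \<in> hom J i j" for u i j
      using that f g XYZ[THEN id_in] unfolding hom_J by (auto simp: K_simps)
    show "FArr K (v \<odot>\<^bsub>J\<^esub> u) = FArr K v \<odot>\<^bsub>C\<^esub> FArr K u"
      if "v \<in> hom J j k" "u \<in> hom J i j" for u v i j k
      using that unfolding hom_J
      by (auto simp: J_simps K_simps id_left[OF f] id_left[OF g] id_right[OF f] id_right[OF g]
          XYZ[THEN id_in, THEN id_left])
  qed (use XYZ in \<open>auto simp: Obj_J Id_J K_simps\<close>)
  moreover have "small \<kappa> (Arr J)"
  proof -
    have "Well_order \<kappa>"
      using co by (simp add: card_order_on_well_order_on)
    moreover have "finite (Field |Arr J| )"
      unfolding Field_card_of by (simp add: J_def)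
    ultimately show ?thesis
      unfolding small_def using finite_ordLess_infinite[OF card_of_Well_order] inf by blast
  qed
  ultimately obtain P \<pi> where lim: "is_limit J C K P \<pi>"
    using compl unfolding complete_cat_def by blast
  \<comment> \<open>A cone is a pair of legs that agree after \<open>f\<close> and \<open>g\<close>;
    the leg to the vertex is forced to be their common composite.\<close>
  have cone_iff: "is_cone J C K W \<rho> \<longleftrightarrow> W \<in> Obj C \<and>
      \<rho> (e LObj) \<in> hom C W X \<and> \<rho> (e RObj) \<in> hom C W Y \<and> \<rho> (e Vertex) \<in> hom C W Z \<and>
      f \<odot>\<^bsub>C\<^esub> \<rho> (e LObj) = \<rho> (e Vertex) \<and> g \<odot>\<^bsub>C\<^esub> \<rho> (e RObj) = \<rho> (e Vertex)" for W \<rho>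
    unfolding is_cone_def Ball_def Arr_J Obj_J by (auto simp: J_simps K_simps id_left)
  have P: "\<pi> (e LObj) \<in> hom C P X" "\<pi> (e RObj) \<in> hom C P Y"
    "f \<odot>\<^bsub>C\<^esub> \<pi> (e LObj) = \<pi> (e Vertex)" "g \<odot>\<^bsub>C\<^esub> \<pi> (e RObj) = \<pi> (e Vertex)"
    using lim unfolding is_limit_def cone_iff by auto
  have "\<exists>!d. d \<in> hom C W P \<and> \<pi> (e LObj) \<odot>\<^bsub>C\<^esub> d = a \<and> \<pi> (e RObj) \<odot>\<^bsub>C\<^esub> d = b"
    if a: "a \<in> hom C W X" and b: "b \<in> hom C W Y" and e: "f \<odot>\<^bsub>C\<^esub> a = g \<odot>\<^bsub>C\<^esub> b" for W a b
  proof -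
    define \<rho> where "\<rho> = (\<lambda>u. if u = e LObj then a else if u = e RObj then b else f \<odot>\<^bsub>C\<^esub> a)"
    have \<rho>: "\<rho> (e LObj) = a" "\<rho> (e RObj) = b" "\<rho> (e Vertex) = f \<odot>\<^bsub>C\<^esub> a"
      by (simp_all add: \<rho>_def)
    have "is_cone J C K W \<rho>"
      unfolding cone_iff \<rho> using a b e comp_in[OF f a] hom_objs by auto
    then have "\<exists>!d. d \<in> hom C W P \<and> (\<forall>j\<in>Obj J. \<pi> j \<odot>\<^bsub>C\<^esub> d = \<rho> j)"
      using lim unfolding is_limit_def by blast
    \<comment> \<open>The equation at the vertex follows from the one at \<open>e LObj\<close> by
      composing with \<open>f\<close>, so two equations characterise the mediating arrow.\<close>
    moreover have "(\<forall>j\<in>Obj J. \<pi> j \<odot>\<^bsub>C\<^esub> d = \<rho> j) \<longleftrightarrow>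
        \<pi> (e LObj) \<odot>\<^bsub>C\<^esub> d = a \<and> \<pi> (e RObj) \<odot>\<^bsub>C\<^esub> d = b" if "d \<in> hom C W P" for d
      using comp_assoc[OF f P(1) that] P(3) by (auto simp: Obj_J \<rho>)
    ultimately show ?thesis by (simp cong: conj_cong)
  qed
  then show "\<exists>P p q. is_pullback C X Y f g P p q"
    using P unfolding is_pullback_def
    by (intro exI[of _ P] exI[of _ "\<pi> (e LObj)"] exI[of _ "\<pi> (e RObj)"]) simp
qed

section \<open>Cancelling monomorphisms and inverting isomorphisms between given objects\<close>

lemma mono_arr_cancel:
  assumes "mono_arr C m" "m \<in> hom C X Y" "f \<in> hom C W X" "g \<in> hom C W X"
    and "m \<odot>\<^bsub>C\<^esub> f = m \<odot>\<^bsub>C\<^esub> g"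
  shows "f = g"
  using assms by (simp add: mono_arr_def hom_def)

lemma iso_arrE:
  assumes "iso_arr C f" "f \<in> hom C X Y"
  obtains g where "g \<in> hom C Y X" "g \<odot>\<^bsub>C\<^esub> f = Id C X" "f \<odot>\<^bsub>C\<^esub> g = Id C Y"
  using assms by (auto simp: iso_arr_def hom_def)

lemma iso_arrI:
  "f \<in> hom C X Y \<Longrightarrow> g \<in> hom C Y X \<Longrightarrow> g \<odot>\<^bsub>C\<^esub> f = Id C X \<Longrightarrow> f \<odot>\<^bsub>C\<^esub> g = Id C Y \<Longrightarrow> iso_arr C f"
  unfolding iso_arr_def by blast

subsection \<open>Adjoint transposition\<close>

context adjunction
begin

lemma unit_in: "X \<in> Obj A \<Longrightarrow> \<eta> X \<in> hom A X (FObj G (FObj F X))"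
  using unit.component_in by (simp add: id_ftor_def comp_ftor_def)

lemma counit_in: "Y \<in> Obj B \<Longrightarrow> \<epsilon> Y \<in> hom B (FObj F (FObj G Y)) Y"
  using counit.component_in by (simp add: id_ftor_def comp_ftor_def)

lemma unit_nat: "f \<in> hom A X Y \<Longrightarrow> \<eta> Y \<odot>\<^bsub>A\<^esub> f = FArr G (FArr F f) \<odot>\<^bsub>A\<^esub> \<eta> X"
  using unit.naturality by (simp add: id_ftor_def comp_ftor_def)

lemma counit_nat: "g \<in> hom B X Y \<Longrightarrow> \<epsilon> Y \<odot>\<^bsub>B\<^esub> FArr F (FArr G g) = g \<odot>\<^bsub>B\<^esub> \<epsilon> X"
  using counit.naturality by (simp add: id_ftor_def comp_ftor_def)

lemma transpose_in:
  "X \<in> Obj A \<Longrightarrow> g \<in> hom B (FObj F X) Y \<Longrightarrow> FArr G g \<odot>\<^bsub>A\<^esub> \<eta> X \<in> hom A X (FObj G Y)"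
  by (meson unit.F.A.comp_in right.arr_in unit_in)

lemma cotranspose_in:
  "Y \<in> Obj B \<Longrightarrow> f \<in> hom A X (FObj G Y) \<Longrightarrow> \<epsilon> Y \<odot>\<^bsub>B\<^esub> FArr F f \<in> hom B (FObj F X) Y"
  by (meson counit.F.A.comp_in left.arr_in counit_in)

text \<open>Naturality of the counit moves \<open>g\<close> to the front, and the triangle identity
  at \<open>X\<close> absorbs what is left.\<close>

lemma cotranspose_transpose:
  assumes X: "X \<in> Obj A" and g: "g \<in> hom B (FObj F X) Y"
  shows "\<epsilon> Y \<odot>\<^bsub>B\<^esub> FArr F (FArr G g \<odot>\<^bsub>A\<^esub> \<eta> X) = g"
proof -
  note Y = counit.F.A.hom_objs[OF g, THEN conjunct2]
  note \<eta> = unit_in[OF X] and Gg = right.arr_in[OF g]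
  have "\<epsilon> Y \<odot>\<^bsub>B\<^esub> FArr F (FArr G g \<odot>\<^bsub>A\<^esub> \<eta> X)
      = (\<epsilon> Y \<odot>\<^bsub>B\<^esub> FArr F (FArr G g)) \<odot>\<^bsub>B\<^esub> FArr F (\<eta> X)"
    using counit.F.A.comp_assoc[OF counit_in[OF Y] left.arr_in[OF Gg] left.arr_in[OF \<eta>]]
    by (simp add: left.pres_comp[OF Gg \<eta>])
  also have "\<dots> = g \<odot>\<^bsub>B\<^esub> (\<epsilon> (FObj F X) \<odot>\<^bsub>B\<^esub> FArr F (\<eta> X))"
    using counit.F.A.comp_assoc[OF g counit_in left.arr_in[OF \<eta>]] left.obj_in[OF X]
    by (simp add: counit_nat[OF g])
  also have "\<dots> = g"
    using triangle_left[OF X] counit.F.A.id_right[OF g] by simp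
  finally show ?thesis .
qed

text \<open>Under this reading transposition and cotransposition are exchanged, so each lemma on one
  of them, instantiated here, gives its mirror image on the other.\<close>

lemma op_adjunction: "adjunction (op_cat B) (op_cat A) G F \<epsilon> \<eta>"
  by (rule adjunction_op_cat) (rule adjunction_axioms)

lemma transpose_cotranspose:
  assumes Y: "Y \<in> Obj B" and f: "f \<in> hom A X (FObj G Y)"
  shows "FArr G (\<epsilon> Y \<odot>\<^bsub>B\<^esub> FArr F f) \<odot>\<^bsub>A\<^esub> \<eta> X = f"
  using adjunction.cotranspose_transpose[OF op_adjunction, of Y f X] Y f by simp

lemma transpose_inj:
  assumes X: "X \<in> Obj A" and g: "g \<in> hom B (FObj F X) Y" and g': "g' \<in> hom B (FObj F X) Y"
    and eq: "FArr G g \<odot>\<^bsub>A\<^esub> \<eta> X = FArr G g' \<odot>\<^bsub>A\<^esub> \<eta> X"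
  shows "g = g'"
  by (metis cotranspose_transpose[OF X g] cotranspose_transpose[OF X g'] eq)

lemma cotranspose_inj:
  assumes Y: "Y \<in> Obj B" and f: "f \<in> hom A X (FObj G Y)" and f': "f' \<in> hom A X (FObj G Y)"
    and eq: "\<epsilon> Y \<odot>\<^bsub>B\<^esub> FArr F f = \<epsilon> Y \<odot>\<^bsub>B\<^esub> FArr F f'"
  shows "f = f'"
  by (metis transpose_cotranspose[OF Y f] transpose_cotranspose[OF Y f'] eq)

lemma transpose_comp_right:
  assumes X: "X \<in> Obj A" and g: "g \<in> hom B (FObj F X) Y" and b: "b \<in> hom B Y Z"
  shows "FArr G (b \<odot>\<^bsub>B\<^esub> g) \<odot>\<^bsub>A\<^esub> \<eta> X = FArr G b \<odot>\<^bsub>A\<^esub> (FArr G g \<odot>\<^bsub>A\<^esub> \<eta> X)"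
  using unit.F.A.comp_assoc[OF right.arr_in[OF b] right.arr_in[OF g] unit_in[OF X]]
  by (simp add: right.pres_comp[OF b g])

text \<open>Naturality of the unit identifies the transpose of \<open>FArr F a\<close> with
  \<open>\<eta> X\<close> after \<open>a\<close>, which reduces the claim to
  \<open>transpose_comp_right\<close>.\<close>

lemma transpose_comp_left:
  assumes a: "a \<in> hom A W X" and g: "g \<in> hom B (FObj F X) Y"
  shows "FArr G (g \<odot>\<^bsub>B\<^esub> FArr F a) \<odot>\<^bsub>A\<^esub> \<eta> W = (FArr G g \<odot>\<^bsub>A\<^esub> \<eta> X) \<odot>\<^bsub>A\<^esub> a"
proof -
  have W: "W \<in> Obj A" and X: "X \<in> Obj A"
    using unit.F.A.hom_objs[OF a] by auto
  have "FArr G (g \<odot>\<^bsub>B\<^esub> FArr F a) \<odot>\<^bsub>A\<^esub> \<eta> W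
      = FArr G g \<odot>\<^bsub>A\<^esub> (FArr G (FArr F a) \<odot>\<^bsub>A\<^esub> \<eta> W)"
    by (rule transpose_comp_right[OF W left.arr_in[OF a] g])
  also have "\<dots> = (FArr G g \<odot>\<^bsub>A\<^esub> \<eta> X) \<odot>\<^bsub>A\<^esub> a"
    using unit.F.A.comp_assoc[OF right.arr_in[OF g] unit_in[OF X] a]
    by (simp add: unit_nat[OF a])
  finally show ?thesis .
qed

lemma cotranspose_comp_left:
  assumes Y: "Y \<in> Obj B" and f: "f \<in> hom A X (FObj G Y)" and a: "a \<in> hom A W X"
  shows "\<epsilon> Y \<odot>\<^bsub>B\<^esub> FArr F (f \<odot>\<^bsub>A\<^esub> a) = (\<epsilon> Y \<odot>\<^bsub>B\<^esub> FArr F f) \<odot>\<^bsub>B\<^esub> FArr F a"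
  using adjunction.transpose_comp_right[OF op_adjunction, of Y f X a W] assms by simp

lemma cotranspose_comp_right:
  assumes b: "b \<in> hom B Y Z" and f: "f \<in> hom A X (FObj G Y)"
  shows "\<epsilon> Z \<odot>\<^bsub>B\<^esub> FArr F (FArr G b \<odot>\<^bsub>A\<^esub> f) = b \<odot>\<^bsub>B\<^esub> (\<epsilon> Y \<odot>\<^bsub>B\<^esub> FArr F f)"
  using adjunction.transpose_comp_left[OF op_adjunction, of b Z Y f X] assms by simp

text \<open>Both sides of the first equation are transposes, of the two sides of the second, and
  transposition is injective. This is what makes transposition respect the morphisms of comma
  categories.\<close>

lemma transpose_square:
  assumes a: "a \<in> hom A X X'" and b: "b \<in> hom B Y Y'"
    and g: "g \<in> hom B (FObj F X) Y" and g': "g' \<in> hom B (FObj F X') Y'"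
  shows "(FArr G g' \<odot>\<^bsub>A\<^esub> \<eta> X') \<odot>\<^bsub>A\<^esub> a = FArr G b \<odot>\<^bsub>A\<^esub> (FArr G g \<odot>\<^bsub>A\<^esub> \<eta> X)
    \<longleftrightarrow> g' \<odot>\<^bsub>B\<^esub> FArr F a = b \<odot>\<^bsub>B\<^esub> g"
proof -
  have X: "X \<in> Obj A"
    using unit.F.A.hom_objs[OF a] by auto
  show ?thesis
    unfolding transpose_comp_left[OF a g', symmetric] transpose_comp_right[OF X g b, symmetric]
    using transpose_inj[OF X] counit.F.A.comp_in left.arr_in[OF a] g g' b by metis
qed

text \<open>By naturality, \<open>\<eta> X\<close> after \<open>f\<close> is the transpose of
  \<open>FArr F f\<close>. Equal composites thus give equal images under the faithful
  \<open>F\<close>. Dually, a faithful right adjoint has epic counit components.\<close>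

lemma mono_arr_unit:
  assumes faith: "faithful A F" and X: "X \<in> Obj A"
  shows "mono_arr A (\<eta> X)"
proof -
  have "f = g" if f: "f \<in> hom A W X" and g: "g \<in> hom A W X"
    and eq: "\<eta> X \<odot>\<^bsub>A\<^esub> f = \<eta> X \<odot>\<^bsub>A\<^esub> g" for W f g
  proof -
    have W: "W \<in> Obj A"
      using unit.F.A.hom_objs[OF f] by auto
    have "FArr F f = FArr F g"
      using transpose_inj[OF W left.arr_in[OF f] left.arr_in[OF g]] eq
      by (simp add: unit_nat[OF f] unit_nat[OF g])
    then show ?thesis
      using faith W X f g unfolding faithful_def inj_on_def by blast
  qed
  then show ?thesis
    using unit_in[OF X] by (auto simp: mono_arr_def hom_def)
qed

text \<open>A diagonal filler for a square from a counit component to a monomorphism. It is the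
  second projection \<open>q\<close> of the pullback of \<open>m\<close> along \<open>v\<close>,
  preceded by the inverse of the first projection \<open>p\<close>; the work lies in inverting
  \<open>p\<close>.\<close>

lemma counit_lifting:
  assumes cons: "conservative B A G" and pb: "has_pullbacks B" and Z: "Z \<in> Obj B"
    and mono: "mono_arr B m" and m: "m \<in> hom B Y Y'"
    and u: "u \<in> hom B (FObj F (FObj G Z)) Y" and v: "v \<in> hom B Z Y'"
    and sq: "m \<odot>\<^bsub>B\<^esub> u = v \<odot>\<^bsub>B\<^esub> \<epsilon> Z"
  shows "\<exists>d\<in>hom B Z Y. d \<odot>\<^bsub>B\<^esub> \<epsilon> Z = u \<and> m \<odot>\<^bsub>B\<^esub> d = v"
proof -
  note assoc = counit.F.A.comp_assoc and comp = counit.F.A.comp_in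
  obtain P p q where pb: "is_pullback B Z Y v m P p q"
    using pb v m unfolding has_pullbacks_def by blast
  then have p: "p \<in> hom B P Z" and q: "q \<in> hom B P Y" and pq: "v \<odot>\<^bsub>B\<^esub> p = m \<odot>\<^bsub>B\<^esub> q"
    unfolding is_pullback_def by simp_all
  \<comment> \<open>\<open>p\<close> is monic, being a pullback of the monomorphism
    \<open>m\<close>.\<close>
  have p_cancel: "f = g" if f: "f \<in> hom B W P" and g: "g \<in> hom B W P"
    and eq: "p \<odot>\<^bsub>B\<^esub> f = p \<odot>\<^bsub>B\<^esub> g" for W f g
  proof -
    have vm: "v \<odot>\<^bsub>B\<^esub> (p \<odot>\<^bsub>B\<^esub> h) = m \<odot>\<^bsub>B\<^esub> (q \<odot>\<^bsub>B\<^esub> h)" if h: "h \<in> hom B W P" for h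
      using assoc[OF v p h] assoc[OF m q h] pq by simp
    have "q \<odot>\<^bsub>B\<^esub> f = q \<odot>\<^bsub>B\<^esub> g"
      using mono_arr_cancel[OF mono m comp[OF q f] comp[OF q g]] vm[OF f] vm[OF g] eq by simp
    then show ?thesis
      using counit.F.A.is_pullback_cancel[OF pb v m f g eq] by simp
  qed
  \<comment> \<open>The given square is a cone over the cospan of \<open>v\<close> and
    \<open>m\<close>, so the counit factors through \<open>p\<close>.\<close>
  obtain k where k: "k \<in> hom B (FObj F (FObj G Z)) P" "p \<odot>\<^bsub>B\<^esub> k = \<epsilon> Z" "q \<odot>\<^bsub>B\<^esub> k = u"
    using is_pullback_factor[OF pb counit_in[OF Z] u sq[symmetric]] .
  have GZ: "FObj G Z \<in> Obj A" and P: "P \<in> Obj B"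
    using right.obj_in[OF Z] counit.F.A.hom_objs[OF p] by auto
  \<comment> \<open>The transpose of \<open>k\<close>. Since \<open>p\<close> after \<open>k\<close>
    is the counit, whose transpose is an identity by the triangle law, \<open>s\<close> is a section
    of \<open>FArr G p\<close>.\<close>
  define s where "s = FArr G k \<odot>\<^bsub>A\<^esub> \<eta> (FObj G Z)"
  have s: "s \<in> hom A (FObj G Z) (FObj G P)"
    unfolding s_def by (rule transpose_in[OF GZ k(1)])
  note Gp = right.arr_in[OF p] and A_comp = unit.F.A.comp_in and A_assoc = unit.F.A.comp_assoc
  have split: "FArr G p \<odot>\<^bsub>A\<^esub> s = Id A (FObj G Z)"
    using transpose_comp_right[OF GZ k(1) p] triangle_right[OF Z] by (simp add: s_def k(2))
  have "s \<odot>\<^bsub>A\<^esub> FArr G p = Id A (FObj G P)"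
  proof -
    define x where "x = s \<odot>\<^bsub>A\<^esub> FArr G p"
    have x: "x \<in> hom A (FObj G P) (FObj G P)"
      unfolding x_def by (rule A_comp[OF s Gp])
    have i: "Id A (FObj G P) \<in> hom A (FObj G P) (FObj G P)"
      using unit.F.A.id_in right.obj_in[OF P] by simp
    have "FArr G p \<odot>\<^bsub>A\<^esub> x = FArr G p \<odot>\<^bsub>A\<^esub> Id A (FObj G P)"
      using A_assoc[OF Gp s Gp] split unit.F.A.id_left[OF Gp] unit.F.A.id_right[OF Gp]
      by (simp add: x_def)
    \<comment> \<open>A right adjoint preserves monomorphisms: cotransposing turns composition with
      \<open>FArr G p\<close> into composition with \<open>p\<close>, which can be cancelled. Hence
      the section is a two-sided inverse.\<close>
    then have "\<epsilon> P \<odot>\<^bsub>B\<^esub> FArr F x = \<epsilon> P \<odot>\<^bsub>B\<^esub> FArr F (Id A (FObj G P))"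
      using p_cancel[OF cotranspose_in[OF P x] cotranspose_in[OF P i]]
        cotranspose_comp_right[OF p x] cotranspose_comp_right[OF p i] by simp
    then show ?thesis
      using cotranspose_inj[OF P x i] by (simp add: x_def)
  qed
  then have "iso_arr A (FArr G p)"
    using Gp s split by (intro iso_arrI)
  then have "iso_arr B p"
    using cons p by (simp add: conservative_def hom_def)
  then obtain j where j: "j \<in> hom B Z P" "j \<odot>\<^bsub>B\<^esub> p = Id B P" "p \<odot>\<^bsub>B\<^esub> j = Id B Z"
    using p by (rule iso_arrE)
  \<comment> \<open>The inverse \<open>j\<close> of \<open>p\<close> cancels \<open>p\<close> in the
    factorisation of the counit, so the filler \<open>q\<close> after \<open>j\<close> restricts to
    \<open>q\<close> after \<open>k\<close>, which is \<open>u\<close>.\<close>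
  have "j \<odot>\<^bsub>B\<^esub> \<epsilon> Z = k"
    using assoc[OF j(1) p k(1)] j(2) k counit.F.A.id_left[OF k(1)] by simp
  then have "(q \<odot>\<^bsub>B\<^esub> j) \<odot>\<^bsub>B\<^esub> \<epsilon> Z = u"
    using assoc[OF q j(1) counit_in[OF Z]] k(3) by simp
  moreover have "m \<odot>\<^bsub>B\<^esub> (q \<odot>\<^bsub>B\<^esub> j) = v"
    using assoc[OF m q j(1)] assoc[OF v p j(1)] pq j(3) counit.F.A.id_right[OF v] by simp
  ultimately show ?thesis
    using comp[OF q j(1)] by blast
qed

text \<open>The dual filler, for a square from an epimorphism to a unit component; \<open>e\<close>
  is epic because it is monic in the opposite category.\<close>

lemma unit_lifting:
  assumes cons: "conservative A B F" and po: "has_pullbacks (op_cat A)" and Z: "Z \<in> Obj A"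
    and epi: "mono_arr (op_cat A) e" and e: "e \<in> hom A Y' Y"
    and u: "u \<in> hom A Y (FObj G (FObj F Z))" and v: "v \<in> hom A Y' Z"
    and sq: "u \<odot>\<^bsub>A\<^esub> e = \<eta> Z \<odot>\<^bsub>A\<^esub> v"
  shows "\<exists>d\<in>hom A Y Z. \<eta> Z \<odot>\<^bsub>A\<^esub> d = u \<and> d \<odot>\<^bsub>A\<^esub> e = v"
  using adjunction.counit_lifting[OF op_adjunction, of Z e Y Y' u v] assms by simp

end

subsection \<open>Left adjoints from universal arrows\<close>

lemma is_functor_id: "category A \<Longrightarrow> is_functor A A id_ftor"
  by (intro is_functor.intro is_functor_axioms.intro) (simp_all add: id_ftor_def)

lemma is_functor_comp:
  assumes F: "is_functor A B F" and G: "is_functor B C G"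
  shows "is_functor A C (comp_ftor G F)"
proof -
  interpret F: is_functor A B F by (rule F)
  interpret G: is_functor B C G by (rule G)
  show ?thesis
    by unfold_locales (auto simp: comp_ftor_def F.obj_in F.pres_id F.pres_comp F.arr_in G.obj_in
        G.arr_in G.pres_id G.pres_comp[OF F.arr_in F.arr_in])
qed

text \<open>A universal arrow from each object is enough: choice fixes them as the unit, and
  uniqueness of factorisations yields all functor, naturality and triangle laws.\<close>

lemma has_left_adjointI:
  assumes G: "is_functor B A G"
    and univ: "\<And>X. X \<in> Obj A \<Longrightarrow> \<exists>Y\<in>Obj B. \<exists>u\<in>hom A X (FObj G Y).
      \<forall>Y'\<in>Obj B. \<forall>f\<in>hom A X (FObj G Y'). \<exists>!g. g \<in> hom B Y Y' \<and> FArr G g \<odot>\<^bsub>A\<^esub> u = f"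
  shows "has_left_adjoint B A G"
proof -
  interpret G: is_functor B A G by fact
  define U where "U X Y u \<longleftrightarrow> Y \<in> Obj B \<and> u \<in> hom A X (FObj G Y) \<and>
    (\<forall>Y'\<in>Obj B. \<forall>f\<in>hom A X (FObj G Y'). \<exists>!g. g \<in> hom B Y Y' \<and> FArr G g \<odot>\<^bsub>A\<^esub> u = f)" for X Y u
  have "\<exists>Y u. U X Y u" if "X \<in> Obj A" for X
    using univ[OF that] unfolding U_def Bex_def by simp
  then obtain T \<eta> where U: "\<And>X. X \<in> Obj A \<Longrightarrow> U X (T X) (\<eta> X)"
    by metis
  have T: "\<And>X. X \<in> Obj A \<Longrightarrow> T X \<in> Obj B"
    and \<eta>: "\<And>X. X \<in> Obj A \<Longrightarrow> \<eta> X \<in> hom A X (FObj G (T X))"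
    and ex1: "\<And>X. X \<in> Obj A \<Longrightarrow> \<forall>Y\<in>Obj B. \<forall>f\<in>hom A X (FObj G Y).
      \<exists>!g. g \<in> hom B (T X) Y \<and> FArr G g \<odot>\<^bsub>A\<^esub> \<eta> X = f"
    using U unfolding U_def by simp_all
  \<comment> \<open>The inverse of transposition: \<open>\<psi> X Y f\<close> is the unique
    factorisation of \<open>f\<close> through the universal arrow at \<open>X\<close>.\<close>
  define \<psi> where "\<psi> X Y f = (THE g. g \<in> hom B (T X) Y \<and> FArr G g \<odot>\<^bsub>A\<^esub> \<eta> X = f)" for X Y f
  have \<psi>: "\<psi> X Y f \<in> hom B (T X) Y" "FArr G (\<psi> X Y f) \<odot>\<^bsub>A\<^esub> \<eta> X = f"
    if "X \<in> Obj A" "Y \<in> Obj B" "f \<in> hom A X (FObj G Y)" for X Y f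
    using theI'[OF ex1[rule_format, OF that]] unfolding \<psi>_def by simp_all
  \<comment> \<open>Arrows out of \<open>T X\<close> are equal once their images under
    \<open>G\<close> agree after \<open>\<eta> X\<close>. Equations between such arrows are proved
    below by this test.\<close>
  have eqI: "g = g'" if "X \<in> Obj A" "g \<in> hom B (T X) Y" "g' \<in> hom B (T X) Y"
    "FArr G g \<odot>\<^bsub>A\<^esub> \<eta> X = FArr G g' \<odot>\<^bsub>A\<^esub> \<eta> X" for X Y g g'
  proof -
    have "Y \<in> Obj B" "FArr G g \<odot>\<^bsub>A\<^esub> \<eta> X \<in> hom A X (FObj G Y)"
      using that(1,2) \<eta> G.A.hom_objs G.arr_in G.B.comp_in by blast+
    from ex1[rule_format, OF that(1) this] show ?thesis
      using that by (elim ex1E) metis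
  qed
  \<comment> \<open>\<open>F\<close> on \<open>f\<close> is forced by naturality of
    \<open>\<eta>\<close>, and \<open>\<epsilon> Y\<close> by the triangle identity at
    \<open>FObj G Y\<close>, which therefore holds by construction.\<close>
  define F where "F = \<lparr>FObj = T,
    FArr = (\<lambda>f. \<psi> (Dom A f) (T (Cod A f)) (\<eta> (Cod A f) \<odot>\<^bsub>A\<^esub> f))\<rparr>"
  define \<epsilon> where "\<epsilon> Y = \<psi> (FObj G Y) Y (Id A (FObj G Y))" for Y
  have F_obj: "FObj F X = T X" for X
    by (simp add: F_def)
  have F_arr: "FArr F f \<in> hom B (T X) (T Y)" "FArr G (FArr F f) \<odot>\<^bsub>A\<^esub> \<eta> X = \<eta> Y \<odot>\<^bsub>A\<^esub> f"
    if f: "f \<in> hom A X Y" for f X Y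
  proof -
    have XY: "X \<in> Obj A" "Y \<in> Obj A"
      using G.B.hom_objs[OF f] by simp_all
    have "FArr F f = \<psi> X (T Y) (\<eta> Y \<odot>\<^bsub>A\<^esub> f)"
      using f by (simp add: F_def hom_def)
    then show "FArr F f \<in> hom B (T X) (T Y)" "FArr G (FArr F f) \<odot>\<^bsub>A\<^esub> \<eta> X = \<eta> Y \<odot>\<^bsub>A\<^esub> f"
      using \<psi>[OF XY(1) T[OF XY(2)] G.B.comp_in[OF \<eta>[OF XY(2)] f]] by simp_all
  qed
  have comp_\<eta>: "FArr G (h \<odot>\<^bsub>B\<^esub> g) \<odot>\<^bsub>A\<^esub> \<eta> X = FArr G h \<odot>\<^bsub>A\<^esub> (FArr G g \<odot>\<^bsub>A\<^esub> \<eta> X)"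
    if "X \<in> Obj A" "g \<in> hom B (T X) Y" "h \<in> hom B Y Z" for X Y Z g h
    using G.B.comp_assoc[OF G.arr_in[OF that(3)] G.arr_in[OF that(2)] \<eta>[OF that(1)]]
    by (simp add: G.pres_comp[OF that(3,2)])
  have F: "is_functor A B F"
  proof
    fix X assume X: "X \<in> Obj A"
    show "FObj F X \<in> Obj B"
      by (simp add: F_obj T[OF X])
    show "FArr F (Id A X) = Id B (FObj F X)"
      unfolding F_obj
    proof (rule eqI[OF X F_arr(1)[OF G.B.id_in[OF X]] G.A.id_in[OF T[OF X]]])
      show "FArr G (FArr F (Id A X)) \<odot>\<^bsub>A\<^esub> \<eta> X = FArr G (Id B (T X)) \<odot>\<^bsub>A\<^esub> \<eta> X"
        using F_arr(2)[OF G.B.id_in[OF X]] G.pres_id[OF T[OF X]] G.B.id_left[OF \<eta>[OF X]]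
          G.B.id_right[OF \<eta>[OF X]] by simp
    qed
  next
    fix f X Y assume "f \<in> hom A X Y"
    then show "FArr F f \<in> hom B (FObj F X) (FObj F Y)"
      by (simp add: F_obj F_arr(1))
  next
    fix g f X Y Z assume g: "g \<in> hom A Y Z" and f: "f \<in> hom A X Y"
    have XZ: "X \<in> Obj A" "Y \<in> Obj A" "Z \<in> Obj A"
      using G.B.hom_objs[OF f] G.B.hom_objs[OF g] by simp_all
    note gf = G.B.comp_in[OF g f]
    show "FArr F (g \<odot>\<^bsub>A\<^esub> f) = FArr F g \<odot>\<^bsub>B\<^esub> FArr F f"
    proof (rule eqI[OF XZ(1) F_arr(1)[OF gf] G.A.comp_in[OF F_arr(1)[OF g] F_arr(1)[OF f]]])
      have "FArr G (FArr F g \<odot>\<^bsub>B\<^esub> FArr F f) \<odot>\<^bsub>A\<^esub> \<eta> X = FArr G (FArr F g) \<odot>\<^bsub>A\<^esub> (\<eta> Y \<odot>\<^bsub>A\<^esub> f)"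
        using comp_\<eta>[OF XZ(1) F_arr(1)[OF f] F_arr(1)[OF g]] F_arr(2)[OF f] by simp
      also have "\<dots> = (\<eta> Z \<odot>\<^bsub>A\<^esub> g) \<odot>\<^bsub>A\<^esub> f"
        using G.B.comp_assoc[OF G.arr_in[OF F_arr(1)[OF g]] \<eta>[OF XZ(2)] f] F_arr(2)[OF g] by simp
      also have "\<dots> = FArr G (FArr F (g \<odot>\<^bsub>A\<^esub> f)) \<odot>\<^bsub>A\<^esub> \<eta> X"
        using G.B.comp_assoc[OF \<eta>[OF XZ(3)] g f] F_arr(2)[OF gf] by simp
      finally show "FArr G (FArr F (g \<odot>\<^bsub>A\<^esub> f)) \<odot>\<^bsub>A\<^esub> \<eta> X =
        FArr G (FArr F g \<odot>\<^bsub>B\<^esub> FArr F f) \<odot>\<^bsub>A\<^esub> \<eta> X" by simp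
    qed
  qed
  interpret F: is_functor A B F by (rule F)
  have \<epsilon>: "\<epsilon> Y \<in> hom B (T (FObj G Y)) Y" "FArr G (\<epsilon> Y) \<odot>\<^bsub>A\<^esub> \<eta> (FObj G Y) = Id A (FObj G Y)"
    if Y: "Y \<in> Obj B" for Y
    using \<psi>[OF G.obj_in[OF Y] Y G.B.id_in[OF G.obj_in[OF Y]]] by (simp_all add: \<epsilon>_def)
  have "adjunction A B F G \<eta> \<epsilon>"
  proof (intro adjunction.intro adjunction_axioms.intro nat_trans.intro nat_trans_axioms.intro F G)
    show "is_functor A A id_ftor" "is_functor B B id_ftor"
      by (intro is_functor_id; unfold_locales)+
    show "is_functor A A (comp_ftor G F)" "is_functor B B (comp_ftor F G)"
      by (intro is_functor_comp[OF F G] is_functor_comp[OF G F])+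
  next
    fix X assume "X \<in> Obj A"
    then show "\<eta> X \<in> hom A (FObj id_ftor X) (FObj (comp_ftor G F) X)"
      by (simp add: id_ftor_def comp_ftor_def F_obj \<eta>)
  next
    fix f X Y assume "f \<in> hom A X Y"
    then show "\<eta> Y \<odot>\<^bsub>A\<^esub> FArr id_ftor f = FArr (comp_ftor G F) f \<odot>\<^bsub>A\<^esub> \<eta> X"
      by (simp add: id_ftor_def comp_ftor_def F_arr(2))
  next
    fix Y assume "Y \<in> Obj B"
    then show "\<epsilon> Y \<in> hom B (FObj (comp_ftor F G) Y) (FObj id_ftor Y)"
      by (simp add: id_ftor_def comp_ftor_def F_obj \<epsilon>)
  next
    fix g X Y assume g: "g \<in> hom B X Y"
    have XY: "X \<in> Obj B" "Y \<in> Obj B"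
      using G.A.hom_objs[OF g] by simp_all
    note Gg = G.arr_in[OF g] and GX = G.obj_in[OF XY(1)] and GY = G.obj_in[OF XY(2)]
    have "\<epsilon> Y \<odot>\<^bsub>B\<^esub> FArr F (FArr G g) = g \<odot>\<^bsub>B\<^esub> \<epsilon> X"
    proof (rule eqI[OF GX G.A.comp_in[OF \<epsilon>(1)[OF XY(2)] F_arr(1)[OF Gg]]
          G.A.comp_in[OF g \<epsilon>(1)[OF XY(1)]]])
      \<comment> \<open>Naturality of the counit: both composites have transpose
        \<open>FArr G g\<close>.\<close>
      have "FArr G (\<epsilon> Y \<odot>\<^bsub>B\<^esub> FArr F (FArr G g)) \<odot>\<^bsub>A\<^esub> \<eta> (FObj G X) = FArr G g"
        using comp_\<eta>[OF GX F_arr(1)[OF Gg] \<epsilon>(1)[OF XY(2)]] F_arr(2)[OF Gg] \<epsilon>(2)[OF XY(2)]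
          G.B.comp_assoc[OF G.arr_in[OF \<epsilon>(1)[OF XY(2)]] \<eta>[OF GY] Gg] G.B.id_left[OF Gg] by simp
      moreover have "FArr G (g \<odot>\<^bsub>B\<^esub> \<epsilon> X) \<odot>\<^bsub>A\<^esub> \<eta> (FObj G X) = FArr G g"
        using comp_\<eta>[OF GX \<epsilon>(1)[OF XY(1)] g] \<epsilon>(2)[OF XY(1)] G.B.id_right[OF Gg] by simp
      ultimately show "FArr G (\<epsilon> Y \<odot>\<^bsub>B\<^esub> FArr F (FArr G g)) \<odot>\<^bsub>A\<^esub> \<eta> (FObj G X) =
        FArr G (g \<odot>\<^bsub>B\<^esub> \<epsilon> X) \<odot>\<^bsub>A\<^esub> \<eta> (FObj G X)" by simp
    qed
    then show "\<epsilon> Y \<odot>\<^bsub>B\<^esub> FArr (comp_ftor F G) g = FArr id_ftor g \<odot>\<^bsub>B\<^esub> \<epsilon> X"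
      by (simp add: id_ftor_def comp_ftor_def)
  next
    fix X assume X: "X \<in> Obj A"
    note TX = T[OF X] and \<eta>X = \<eta>[OF X]
    note GTX = G.obj_in[OF TX]
    have "\<epsilon> (T X) \<odot>\<^bsub>B\<^esub> FArr F (\<eta> X) = Id B (T X)"
    proof (rule eqI[OF X G.A.comp_in[OF \<epsilon>(1)[OF TX] F_arr(1)[OF \<eta>X]] G.A.id_in[OF TX]])
      have "FArr G (\<epsilon> (T X) \<odot>\<^bsub>B\<^esub> FArr F (\<eta> X)) \<odot>\<^bsub>A\<^esub> \<eta> X = \<eta> X"
        using comp_\<eta>[OF X F_arr(1)[OF \<eta>X] \<epsilon>(1)[OF TX]] F_arr(2)[OF \<eta>X] \<epsilon>(2)[OF TX]
          G.B.comp_assoc[OF G.arr_in[OF \<epsilon>(1)[OF TX]] \<eta>[OF GTX] \<eta>X] G.B.id_left[OF \<eta>X] by simp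
      then show "FArr G (\<epsilon> (T X) \<odot>\<^bsub>B\<^esub> FArr F (\<eta> X)) \<odot>\<^bsub>A\<^esub> \<eta> X = FArr G (Id B (T X)) \<odot>\<^bsub>A\<^esub> \<eta> X"
        using G.pres_id[OF TX] G.B.id_left[OF \<eta>X] by simp
    qed
    then show "\<epsilon> (FObj F X) \<odot>\<^bsub>B\<^esub> FArr F (\<eta> X) = Id B (FObj F X)"
      by (simp add: F_obj)
  qed (rule \<epsilon>(2))
  then show ?thesis
    unfolding has_left_adjoint_def by blast
qed

subsection \<open>Comma categories\<close>

lemma comma_simps [simp]:
  "Obj (comma X Y Z P Q) = comma_objs X Y Z P Q"
  "Id (comma X Y Z P Q) (x, y, h) = ((x, y, h), (x, y, h), (Id X x, Id Y y))"
  "(s', t', (a', b')) \<odot>\<^bsub>comma X Y Z P Q\<^esub> (s, t, (a, b)) = (s, t', (a' \<odot>\<^bsub>X\<^esub> a, b' \<odot>\<^bsub>Y\<^esub> b))"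
  by (simp_all add: comma_def)

lemma comma_objs_iff:
  "(x, y, h) \<in> comma_objs X Y Z P Q \<longleftrightarrow>
     x \<in> Obj X \<and> y \<in> Obj Y \<and> h \<in> hom Z (FObj P x) (FObj Q y)"
  by (simp add: comma_objs_def)

lemma hom_commaI:
  assumes "(x, y, h) \<in> comma_objs X Y Z P Q" "(x', y', h') \<in> comma_objs X Y Z P Q"
    and "a \<in> hom X x x'" "b \<in> hom Y y y'" "h' \<odot>\<^bsub>Z\<^esub> FArr P a = FArr Q b \<odot>\<^bsub>Z\<^esub> h"
  shows "((x, y, h), (x', y', h'), (a, b)) \<in> hom (comma X Y Z P Q) (x, y, h) (x', y', h')"
  using assms by (simp add: hom_def comma_def comma_arrs_def)

lemma hom_commaE:
  assumes "g \<in> hom (comma X Y Z P Q) s t"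
  obtains x y h x' y' h' a b where
    "s = (x, y, h)" "t = (x', y', h')" "g = ((x, y, h), (x', y', h'), (a, b))"
    "(x, y, h) \<in> comma_objs X Y Z P Q" "(x', y', h') \<in> comma_objs X Y Z P Q"
    "a \<in> hom X x x'" "b \<in> hom Y y y'" "h' \<odot>\<^bsub>Z\<^esub> FArr P a = FArr Q b \<odot>\<^bsub>Z\<^esub> h"
proof -
  obtain x y h x' y' h' a b where g: "g = ((x, y, h), (x', y', h'), (a, b))"
    by (metis surj_pair)
  show thesis
    using assms unfolding g by (intro that[OF _ _ g]) (auto simp: hom_def comma_def comma_arrs_def)
qed

lemma category_comma:
  assumes "is_functor X Z P" "is_functor Y Z Q"
  shows "category (comma X Y Z P Q)"
proof -
  interpret P: is_functor X Z P by fact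
  interpret Q: is_functor Y Z Q by fact
  show ?thesis
  proof
    fix g assume g: "g \<in> Arr (comma X Y Z P Q)"
    then show "Dom (comma X Y Z P Q) g \<in> Obj (comma X Y Z P Q)"
      "Cod (comma X Y Z P Q) g \<in> Obj (comma X Y Z P Q)"
      by (auto simp: comma_def comma_arrs_def)
  next
    fix s assume s: "s \<in> Obj (comma X Y Z P Q)"
    obtain x y h where [simp]: "s = (x, y, h)" by (cases s)
    have x: "x \<in> Obj X" and y: "y \<in> Obj Y" and h: "h \<in> hom Z (FObj P x) (FObj Q y)"
      using s by (simp_all add: comma_objs_iff)
    show "Id (comma X Y Z P Q) s \<in> hom (comma X Y Z P Q) s s"
      using s P.A.id_in[OF x] Q.A.id_in[OF y] P.B.id_left[OF h] P.B.id_right[OF h]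
      by (auto intro!: hom_commaI simp: P.pres_id[OF x] Q.pres_id[OF y])
  next
    fix g f r s t
    assume gf: "g \<in> hom (comma X Y Z P Q) s t" "f \<in> hom (comma X Y Z P Q) r s"
    obtain x y h x' y' h' x'' y'' h'' where
      [simp]: "r = (x, y, h)" "s = (x', y', h')" "t = (x'', y'', h'')"
      by (cases r; cases s; cases t) simp
    obtain a b where [simp]: "f = ((x, y, h), (x', y', h'), (a, b))"
      and f: "(x, y, h) \<in> comma_objs X Y Z P Q" "(x', y', h') \<in> comma_objs X Y Z P Q"
        "a \<in> hom X x x'" "b \<in> hom Y y y'" "h' \<odot>\<^bsub>Z\<^esub> FArr P a = FArr Q b \<odot>\<^bsub>Z\<^esub> h"
      using gf(2) by (auto elim!: hom_commaE)
    obtain a' b' where [simp]: "g = ((x', y', h'), (x'', y'', h''), (a', b'))"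
      and g: "(x'', y'', h'') \<in> comma_objs X Y Z P Q" "a' \<in> hom X x' x''" "b' \<in> hom Y y' y''"
        "h'' \<odot>\<^bsub>Z\<^esub> FArr P a' = FArr Q b' \<odot>\<^bsub>Z\<^esub> h'"
      using gf(1) by (auto elim!: hom_commaE)
    note objs = f(1,2) g(1) and ab = f(3,4) g(2,3) and sq = f(5) g(4)
    have h: "h \<in> hom Z (FObj P x) (FObj Q y)" "h' \<in> hom Z (FObj P x') (FObj Q y')"
        "h'' \<in> hom Z (FObj P x'') (FObj Q y'')"
      using objs by (simp_all add: comma_objs_iff)
    note Pa = P.arr_in[OF ab(1)] P.arr_in[OF ab(3)] and Qb = Q.arr_in[OF ab(2)] Q.arr_in[OF ab(4)]
    \<comment> \<open>The squares of \<open>f\<close> and \<open>g\<close> are pasted along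
      \<open>h'\<close>.\<close>
    have "h'' \<odot>\<^bsub>Z\<^esub> FArr P (a' \<odot>\<^bsub>X\<^esub> a) = (h'' \<odot>\<^bsub>Z\<^esub> FArr P a') \<odot>\<^bsub>Z\<^esub> FArr P a"
      using P.B.comp_assoc[OF h(3) Pa(2,1)] by (simp add: P.pres_comp[OF ab(3,1)])
    also have "\<dots> = FArr Q b' \<odot>\<^bsub>Z\<^esub> (FArr Q b \<odot>\<^bsub>Z\<^esub> h)"
      using P.B.comp_assoc[OF Qb(2) h(2) Pa(1)] by (simp add: sq)
    also have "\<dots> = FArr Q (b' \<odot>\<^bsub>Y\<^esub> b) \<odot>\<^bsub>Z\<^esub> h"
      using P.B.comp_assoc[OF Qb(2,1) h(1)] by (simp add: Q.pres_comp[OF ab(4,2)])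
    finally show "g \<odot>\<^bsub>comma X Y Z P Q\<^esub> f \<in> hom (comma X Y Z P Q) r t"
      using objs P.A.comp_in[OF ab(3,1)] Q.A.comp_in[OF ab(4,2)] by (auto intro!: hom_commaI)
  next
    fix f s t assume "f \<in> hom (comma X Y Z P Q) s t"
    then show "Id (comma X Y Z P Q) t \<odot>\<^bsub>comma X Y Z P Q\<^esub> f = f"
      "f \<odot>\<^bsub>comma X Y Z P Q\<^esub> Id (comma X Y Z P Q) s = f"
      by (auto elim!: hom_commaE simp: P.A.id_left P.A.id_right Q.A.id_left Q.A.id_right)
  next
    fix h g f r s t u
    assume "h \<in> hom (comma X Y Z P Q) s t" "g \<in> hom (comma X Y Z P Q) r s"
      "f \<in> hom (comma X Y Z P Q) u r"
    then show "(h \<odot>\<^bsub>comma X Y Z P Q\<^esub> g) \<odot>\<^bsub>comma X Y Z P Q\<^esub> f =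
        h \<odot>\<^bsub>comma X Y Z P Q\<^esub> (g \<odot>\<^bsub>comma X Y Z P Q\<^esub> f)"
      by (elim hom_commaE) (simp add: P.A.comp_assoc Q.A.comp_assoc)
  qed
qed

section \<open>Isomorphisms of comma categories that change only the structure maps\<close>

lemma on_structure_map_functor:
  fixes X :: "('ox, 'ax) cat" and Y :: "('oy, 'ay) cat"
    and Z :: "('oz, 'az) cat" and Z' :: "('ow, 'aw) cat"
  assumes C: "category (comma X Y Z P Q)" and C': "category (comma X Y Z' P' Q')"
    and t: "\<And>x y h. \<lbrakk>x \<in> Obj X; y \<in> Obj Y; h \<in> hom Z (FObj P x) (FObj Q y)\<rbrakk>
      \<Longrightarrow> t x y h \<in> hom Z' (FObj P' x) (FObj Q' y)"
    and sq: "\<And>x y h x' y' h' a b. \<lbrakk>a \<in> hom X x x'; b \<in> hom Y y y';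
        h \<in> hom Z (FObj P x) (FObj Q y); h' \<in> hom Z (FObj P x') (FObj Q y');
        h' \<odot>\<^bsub>Z\<^esub> FArr P a = FArr Q b \<odot>\<^bsub>Z\<^esub> h\<rbrakk>
      \<Longrightarrow> t x' y' h' \<odot>\<^bsub>Z'\<^esub> FArr P' a = FArr Q' b \<odot>\<^bsub>Z'\<^esub> t x y h"
  shows "is_functor (comma X Y Z P Q) (comma X Y Z' P' Q') (on_structure_map t)"
proof (intro is_functor.intro is_functor_axioms.intro C C')
  let ?T = "on_structure_map t ::
    (('ox, 'oy, 'az) comma_obj, ('ox, 'ax, 'oy, 'ay, 'az) comma_arr,
     ('ox, 'oy, 'aw) comma_obj, ('ox, 'ax, 'oy, 'ay, 'aw) comma_arr) ftor"
  have T: "FObj ?T (x, y, h) = (x, y, t x y h)"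
    "FArr ?T ((x, y, h), (x', y', h'), c) = ((x, y, t x y h), (x', y', t x' y' h'), c)"
    for x y h x' y' h' c
    by (cases c; simp add: on_structure_map_def Let_def)+
  show "FObj ?T s \<in> Obj (comma X Y Z' P' Q')" if "s \<in> Obj (comma X Y Z P Q)" for s
    using that by (cases s) (auto simp: T comma_objs_iff t)
  show "FArr ?T f \<in> hom (comma X Y Z' P' Q') (FObj ?T s) (FObj ?T r)"
    if "f \<in> hom (comma X Y Z P Q) s r" for f s r
    using that
    by (elim hom_commaE) (auto simp: T comma_objs_iff intro!: hom_commaI t sq)
  show "FArr ?T (Id (comma X Y Z P Q) s) = Id (comma X Y Z' P' Q') (FObj ?T s)" for s
    by (cases s) (simp add: T)
  show "FArr ?T (g \<odot>\<^bsub>comma X Y Z P Q\<^esub> f) = FArr ?T g \<odot>\<^bsub>comma X Y Z' P' Q'\<^esub> FArr ?T f"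
    if "g \<in> hom (comma X Y Z P Q) s r" "f \<in> hom (comma X Y Z P Q) q s" for g f q s r
    using that by (elim hom_commaE) (simp add: T)
qed

text \<open>The hypothesis \<open>sq\<close> is an equivalence, so that it also yields the squares
  for the inverse \<open>t'\<close>. The pairs of arrows are left alone, so the inverse laws concern
  structure maps only.\<close>

lemma on_structure_map_iso:
  fixes X :: "('ox, 'ax) cat" and Y :: "('oy, 'ay) cat"
    and Z :: "('oz, 'az) cat" and Z' :: "('ow, 'aw) cat"
  assumes C: "category (comma X Y Z P Q)" and C': "category (comma X Y Z' P' Q')"
    and t: "\<And>x y h. \<lbrakk>x \<in> Obj X; y \<in> Obj Y; h \<in> hom Z (FObj P x) (FObj Q y)\<rbrakk>
      \<Longrightarrow> t x y h \<in> hom Z' (FObj P' x) (FObj Q' y) \<and> t' x y (t x y h) = h"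
    and t': "\<And>x y h. \<lbrakk>x \<in> Obj X; y \<in> Obj Y; h \<in> hom Z' (FObj P' x) (FObj Q' y)\<rbrakk>
      \<Longrightarrow> t' x y h \<in> hom Z (FObj P x) (FObj Q y) \<and> t x y (t' x y h) = h"
    and sq: "\<And>x y h x' y' h' a b. \<lbrakk>a \<in> hom X x x'; b \<in> hom Y y y';
        h \<in> hom Z (FObj P x) (FObj Q y); h' \<in> hom Z (FObj P x') (FObj Q y')\<rbrakk>
      \<Longrightarrow> t x' y' h' \<odot>\<^bsub>Z'\<^esub> FArr P' a = FArr Q' b \<odot>\<^bsub>Z'\<^esub> t x y h
        \<longleftrightarrow> h' \<odot>\<^bsub>Z\<^esub> FArr P a = FArr Q b \<odot>\<^bsub>Z\<^esub> h"
    and cats: "category X" "category Y"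
  shows "cat_isomorphism (comma X Y Z P Q) (comma X Y Z' P' Q') (on_structure_map t)"
  unfolding cat_isomorphism_def
proof (intro conjI exI[of _ "on_structure_map t'"] ballI)
  show "is_functor (comma X Y Z P Q) (comma X Y Z' P' Q') (on_structure_map t)"
    by (rule on_structure_map_functor[OF C C']) (simp_all add: t sq)
  show "is_functor (comma X Y Z' P' Q') (comma X Y Z P Q) (on_structure_map t')"
  proof (rule on_structure_map_functor[OF C' C])
    fix x y h x' y' h' a b
    assume a: "a \<in> hom X x x'" and b: "b \<in> hom Y y y'"
      and h: "h \<in> hom Z' (FObj P' x) (FObj Q' y)" "h' \<in> hom Z' (FObj P' x') (FObj Q' y')"
      and eq: "h' \<odot>\<^bsub>Z'\<^esub> FArr P' a = FArr Q' b \<odot>\<^bsub>Z'\<^esub> h"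
    have objs: "x \<in> Obj X" "x' \<in> Obj X" "y \<in> Obj Y" "y' \<in> Obj Y"
      using category.hom_objs[OF cats(1) a] category.hom_objs[OF cats(2) b] by simp_all
    show "t' x' y' h' \<odot>\<^bsub>Z\<^esub> FArr P a = FArr Q b \<odot>\<^bsub>Z\<^esub> t' x y h"
      \<comment> \<open>\<open>sq\<close> is read backwards at the images under \<open>t'\<close>,
        where applying \<open>t\<close> gives back \<open>h\<close> and \<open>h'\<close>.\<close>
      using sq[OF a b t'[OF objs(1,3) h(1), THEN conjunct1] t'[OF objs(2,4) h(2), THEN conjunct1]]
        t'[OF objs(1,3) h(1)] t'[OF objs(2,4) h(2)] eq by simp
  qed (simp add: t')
qed (auto simp: on_structure_map_def Let_def comma_objs_iff comma_def comma_arrs_def t t')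

lemma transpose_FG_iso:
  assumes FG: "adjunction B C F G \<eta> \<epsilon>" and R: "is_functor D C R"
  shows "cat_isomorphism (comma B D C F R) (comma B D B id_ftor (comp_ftor G R)) (transpose_FG B G \<eta>)"
proof -
  interpret FG: adjunction B C F G \<eta> \<epsilon> by (rule FG)
  interpret R: is_functor D C R by (rule R)
  show ?thesis
    unfolding transpose_FG_def
  proof (rule on_structure_map_iso[where t' = "\<lambda>X Y h. \<epsilon> (FObj R Y) \<odot>\<^bsub>C\<^esub> FArr F h"])
    show "category (comma B D C F R)"
      by (rule category_comma) unfold_locales
    show "category (comma B D B id_ftor (comp_ftor G R))"
      by (intro category_comma is_functor_id is_functor_comp[OF R]) unfold_locales
    show "category B" "category D"
      by unfold_locales
  next
    fix x y h x' y' h' a b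
    assume a: "a \<in> hom B x x'" and b: "b \<in> hom D y y'"
      and h: "h \<in> hom C (FObj F x) (FObj R y)" "h' \<in> hom C (FObj F x') (FObj R y')"
    show "(FArr G h' \<odot>\<^bsub>B\<^esub> \<eta> x') \<odot>\<^bsub>B\<^esub> FArr id_ftor a =
        FArr (comp_ftor G R) b \<odot>\<^bsub>B\<^esub> (FArr G h \<odot>\<^bsub>B\<^esub> \<eta> x) \<longleftrightarrow>
        h' \<odot>\<^bsub>C\<^esub> FArr F a = FArr R b \<odot>\<^bsub>C\<^esub> h"
      using FG.transpose_square[OF a R.arr_in[OF b] h] by (simp add: id_ftor_def comp_ftor_def)
  qed (simp_all add: id_ftor_def comp_ftor_def FG.transpose_in FG.cotranspose_in R.obj_in
      FG.cotranspose_transpose FG.transpose_cotranspose)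
qed

lemma transpose_LR_iso:
  assumes LR: "adjunction C D L R \<eta> \<epsilon>" and F: "is_functor B C F"
  shows "cat_isomorphism (comma B D C F R) (comma B D D (comp_ftor L F) id_ftor) (transpose_LR D L \<epsilon>)"
proof -
  interpret LR: adjunction C D L R \<eta> \<epsilon> by (rule LR)
  interpret F: is_functor B C F by (rule F)
  show ?thesis
    unfolding transpose_LR_def
  proof (rule on_structure_map_iso[where t' = "\<lambda>X Y h. FArr R h \<odot>\<^bsub>C\<^esub> \<eta> (FObj F X)"])
    show "category (comma B D C F R)"
      by (rule category_comma) unfold_locales
    show "category (comma B D D (comp_ftor L F) id_ftor)"
      by (intro category_comma is_functor_id is_functor_comp[OF F]) unfold_locales
    show "category B" "category D"
      by unfold_locales
  next
    fix x y h x' y' h' a b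
    assume a: "a \<in> hom B x x'" and b: "b \<in> hom D y y'"
      and h: "h \<in> hom C (FObj F x) (FObj R y)" "h' \<in> hom C (FObj F x') (FObj R y')"
    have y: "y \<in> Obj D" "y' \<in> Obj D"
      using LR.counit.F.A.hom_objs[OF b] by simp_all
    show "(\<epsilon> y' \<odot>\<^bsub>D\<^esub> FArr L h') \<odot>\<^bsub>D\<^esub> FArr (comp_ftor L F) a =
        FArr id_ftor b \<odot>\<^bsub>D\<^esub> (\<epsilon> y \<odot>\<^bsub>D\<^esub> FArr L h) \<longleftrightarrow>
        h' \<odot>\<^bsub>C\<^esub> FArr F a = FArr R b \<odot>\<^bsub>C\<^esub> h"
      \<comment> \<open>Here the structure maps go through cotransposition, so
        \<open>transpose_square\<close> is applied to the cotransposes of \<open>h\<close> and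
        \<open>h'\<close>, whose transposes are \<open>h\<close> and \<open>h'\<close>
        again.\<close>
      using LR.transpose_square[OF F.arr_in[OF a] b LR.cotranspose_in[OF y(1) h(1)]
          LR.cotranspose_in[OF y(2) h(2)]]
      by (simp add: id_ftor_def comp_ftor_def LR.transpose_cotranspose h y)
  qed (simp_all add: id_ftor_def comp_ftor_def LR.transpose_in LR.cotranspose_in F.obj_in
      LR.cotranspose_transpose LR.transpose_cotranspose)
qed

subsection \<open>The embedding into the comma category\<close>

locale adjoint_pair =
  FG: adjunction B C F G \<eta>FG \<epsilon>FG + LR: adjunction C D L R \<eta>LR \<epsilon>LR
  for B :: "('ob, 'ab) cat" and C :: "('oc, 'ac) cat" and D :: "('od, 'ad) cat"
    and F :: "('ob, 'ab, 'oc, 'ac) ftor" and G :: "('oc, 'ac, 'ob, 'ab) ftor"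
    and L :: "('oc, 'ac, 'od, 'ad) ftor" and R :: "('od, 'ad, 'oc, 'ac) ftor"
    and \<eta>FG \<epsilon>FG \<eta>LR \<epsilon>LR
begin

abbreviation "\<gamma> \<equiv> gamma C G L \<epsilon>FG \<eta>LR"

lemma gamma_FObj: "FObj \<gamma> A = (FObj G A, FObj L A, \<eta>LR A \<odot>\<^bsub>C\<^esub> \<epsilon>FG A)"
  by (simp add: gamma_def gamma_obj_def)

lemma gamma_FArr:
  "f \<in> hom C A A' \<Longrightarrow> FArr \<gamma> f = (FObj \<gamma> A, FObj \<gamma> A', (FArr G f, FArr L f))"
  by (simp add: gamma_def hom_def)

lemma gamma_map_in: "A \<in> Obj C \<Longrightarrow> \<eta>LR A \<odot>\<^bsub>C\<^esub> \<epsilon>FG A \<in> hom C (FObj F (FObj G A)) (FObj R (FObj L A))"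
  by (rule FG.counit.F.A.comp_in[OF LR.unit_in FG.counit_in])

lemma gamma_FObj_in: "A \<in> Obj C \<Longrightarrow> FObj \<gamma> A \<in> comma_objs B D C F R"
  by (simp add: gamma_FObj comma_objs_iff FG.right.obj_in LR.left.obj_in gamma_map_in)

lemma functor_F: "is_functor B C F" and functor_R: "is_functor D C R"
  by unfold_locales

lemma category_FR: "category (comma B D C F R)"
  by (rule category_comma[OF functor_F functor_R])

lemma gamma_functor: "is_functor C (comma B D C F R) \<gamma>"
proof (intro is_functor.intro is_functor_axioms.intro category_FR)
  show "category C" by unfold_locales
next
  fix A assume A: "A \<in> Obj C"
  show "FObj \<gamma> A \<in> Obj (comma B D C F R)"
    by (simp add: gamma_FObj_in[OF A])
  show "FArr \<gamma> (Id C A) = Id (comma B D C F R) (FObj \<gamma> A)"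
    by (simp add: gamma_FArr[OF FG.counit.F.A.id_in[OF A]] FG.right.pres_id[OF A] LR.left.pres_id[OF A]
        gamma_FObj)
next
  fix f A A' assume f: "f \<in> hom C A A'"
  have A: "A \<in> Obj C" "A' \<in> Obj C"
    using FG.counit.F.A.hom_objs[OF f] by simp_all
  note assoc = FG.counit.F.A.comp_assoc
  \<comment> \<open>Two naturality squares are pasted: the counit of \<open>F\<close>,
    \<open>G\<close> moves past \<open>f\<close>, then the unit of \<open>L\<close>,
    \<open>R\<close> does.\<close>
  have "(\<eta>LR A' \<odot>\<^bsub>C\<^esub> \<epsilon>FG A') \<odot>\<^bsub>C\<^esub> FArr F (FArr G f) = (\<eta>LR A' \<odot>\<^bsub>C\<^esub> f) \<odot>\<^bsub>C\<^esub> \<epsilon>FG A"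
    using assoc[OF LR.unit_in[OF A(2)] FG.counit_in[OF A(2)] FG.left.arr_in[OF FG.right.arr_in[OF f]]]
      assoc[OF LR.unit_in[OF A(2)] f FG.counit_in[OF A(1)]] FG.counit_nat[OF f] by simp
  also have "\<dots> = FArr R (FArr L f) \<odot>\<^bsub>C\<^esub> (\<eta>LR A \<odot>\<^bsub>C\<^esub> \<epsilon>FG A)"
    using assoc[OF LR.right.arr_in[OF LR.left.arr_in[OF f]] LR.unit_in[OF A(1)] FG.counit_in[OF A(1)]]
      LR.unit_nat[OF f] by simp
  finally show "FArr \<gamma> f \<in> hom (comma B D C F R) (FObj \<gamma> A) (FObj \<gamma> A')"
    using gamma_FObj_in[OF A(1)] gamma_FObj_in[OF A(2)] FG.right.arr_in[OF f] LR.left.arr_in[OF f]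
    unfolding gamma_FArr[OF f] gamma_FObj by (intro hom_commaI)
next
  fix g f X Y Z assume g: "g \<in> hom C Y Z" and f: "f \<in> hom C X Y"
  show "FArr \<gamma> (g \<odot>\<^bsub>C\<^esub> f) = FArr \<gamma> g \<odot>\<^bsub>comma B D C F R\<^esub> FArr \<gamma> f"
    by (simp add: gamma_FArr[OF g] gamma_FArr[OF f] gamma_FArr[OF FG.counit.F.A.comp_in[OF g f]]
        FG.right.pres_comp[OF g f] LR.left.pres_comp[OF g f])
qed

section \<open>Faithfulness and fullness of the embedding\<close>

lemma gamma_faithful:
  assumes "faithful C G"
  shows "faithful C \<gamma>"
  unfolding faithful_def
proof (intro ballI inj_onI)
  fix A A' f g
  assume A: "A \<in> Obj C" "A' \<in> Obj C" and f: "f \<in> hom C A A'" and g: "g \<in> hom C A A'"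
    and eq: "FArr \<gamma> f = FArr \<gamma> g"
  have "FArr G f = FArr G g"
    using eq by (simp add: gamma_FArr[OF f] gamma_FArr[OF g])
  with assms A f g show "f = g"
    unfolding faithful_def inj_on_def by blast
qed

lemma mono_arr_unit_LR: "faithful C L \<Longrightarrow> A \<in> Obj C \<Longrightarrow> mono_arr C (\<eta>LR A)"
  by (rule LR.mono_arr_unit)

lemma epi_arr_counit_FG: "faithful C G \<Longrightarrow> A \<in> Obj C \<Longrightarrow> mono_arr (op_cat C) (\<epsilon>FG A)"
  using adjunction.mono_arr_unit[OF FG.op_adjunction] by simp

lemma gamma_full:
  assumes faith: "faithful C G" "faithful C L"
    and cons: "conservative C B G \<or> conservative C D L"
    and pb: "has_pullbacks C" and po: "has_pullbacks (op_cat C)"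
  shows "full C (comma B D C F R) \<gamma>"
  unfolding full_def
proof (intro ballI subsetI)
  fix A A' g
  assume A: "A \<in> Obj C" and A': "A' \<in> Obj C"
    and g: "g \<in> hom (comma B D C F R) (FObj \<gamma> A) (FObj \<gamma> A')"
  obtain a b where g_eq: "g = (FObj \<gamma> A, FObj \<gamma> A', (a, b))"
    and a: "a \<in> hom B (FObj G A) (FObj G A')" and b: "b \<in> hom D (FObj L A) (FObj L A')"
    and sq: "(\<eta>LR A' \<odot>\<^bsub>C\<^esub> \<epsilon>FG A') \<odot>\<^bsub>C\<^esub> FArr F a = FArr R b \<odot>\<^bsub>C\<^esub> (\<eta>LR A \<odot>\<^bsub>C\<^esub> \<epsilon>FG A)"
    using g unfolding gamma_FObj by (auto elim!: hom_commaE)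
  note \<epsilon>A = FG.counit_in[OF A] and \<eta>A' = LR.unit_in[OF A']
  \<comment> \<open>\<open>u\<close> and \<open>v\<close> are the arrows of \<open>C\<close>
    corresponding to \<open>a\<close> and \<open>b\<close>. In these terms the comma square runs
    from the counit at \<open>A\<close> to the unit at \<open>A'\<close>, and a diagonal
    \<open>d\<close> of it is the required preimage.\<close>
  define u where "u = \<epsilon>FG A' \<odot>\<^bsub>C\<^esub> FArr F a"
  define v where "v = FArr R b \<odot>\<^bsub>C\<^esub> \<eta>LR A"
  have u: "u \<in> hom C (FObj F (FObj G A)) A'"
    unfolding u_def by (rule FG.cotranspose_in[OF A' a])
  have v: "v \<in> hom C A (FObj R (FObj L A'))"
    unfolding v_def by (rule LR.transpose_in[OF A b])
  have uv: "\<eta>LR A' \<odot>\<^bsub>C\<^esub> u = v \<odot>\<^bsub>C\<^esub> \<epsilon>FG A"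
    using FG.counit.F.A.comp_assoc[OF \<eta>A' FG.counit_in[OF A'] FG.left.arr_in[OF a]]
      FG.counit.F.A.comp_assoc[OF LR.right.arr_in[OF b] LR.unit_in[OF A] \<epsilon>A] sq
    by (simp add: u_def v_def)
  have "\<exists>d\<in>hom C A A'. d \<odot>\<^bsub>C\<^esub> \<epsilon>FG A = u \<and> \<eta>LR A' \<odot>\<^bsub>C\<^esub> d = v"
    using cons
  proof
    assume "conservative C B G"
    then show ?thesis
      by (rule FG.counit_lifting[OF _ pb A mono_arr_unit_LR[OF faith(2) A'] \<eta>A' u v uv])
  next
    assume "conservative C D L"
    then have "\<exists>d\<in>hom C A A'. \<eta>LR A' \<odot>\<^bsub>C\<^esub> d = v \<and> d \<odot>\<^bsub>C\<^esub> \<epsilon>FG A = u"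
      by (rule LR.unit_lifting[OF _ po A' epi_arr_counit_FG[OF faith(1) A] \<epsilon>A v u uv[symmetric]])
    then show ?thesis by blast
  qed
  then obtain d where d: "d \<in> hom C A A'" "d \<odot>\<^bsub>C\<^esub> \<epsilon>FG A = u" "\<eta>LR A' \<odot>\<^bsub>C\<^esub> d = v"
    by blast
  \<comment> \<open>By naturality of the counit, \<open>FArr G d\<close> and \<open>a\<close> have
    the same cotranspose \<open>u\<close>. In the same way \<open>FArr L d\<close> and
    \<open>b\<close> have the same transpose \<open>v\<close>.\<close>
  have "FArr G d = a"
    using FG.cotranspose_inj[OF A' FG.right.arr_in[OF d(1)] a] FG.counit_nat[OF d(1)] d(2)
    by (simp add: u_def)
  moreover have "FArr L d = b"
    using LR.transpose_inj[OF A LR.left.arr_in[OF d(1)] b] LR.unit_nat[OF d(1)] d(3)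
    by (simp add: v_def)
  ultimately have "FArr \<gamma> d = g"
    by (simp add: gamma_FArr[OF d(1)] g_eq)
  then show "g \<in> FArr \<gamma> ` hom C A A'"
    using d(1) by blast
qed

end

section \<open>The left adjoint of the embedding, obtained from pushouts\<close>

locale adjoint_triple = adjoint_pair B C D F G L R \<eta>FG \<epsilon>FG \<eta>LR \<epsilon>LR + SL: adjunction D C S L \<eta>SL \<epsilon>SL
  for B :: "('ob, 'ab) cat" and C :: "('oc, 'ac) cat" and D :: "('od, 'ad) cat"
    and F :: "('ob, 'ab, 'oc, 'ac) ftor" and G :: "('oc, 'ac, 'ob, 'ab) ftor"
    and L :: "('oc, 'ac, 'od, 'ad) ftor" and R :: "('od, 'ad, 'oc, 'ac) ftor"
    and \<eta>FG \<epsilon>FG \<eta>LR \<epsilon>LR and S and \<eta>SL \<epsilon>SL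
begin

text \<open>The comma condition is moved into \<open>C\<close>. Both of its sides are transposes
  along \<open>L\<close>, \<open>R\<close>, of \<open>FArr L a\<close> and of an arrow through
  \<open>Y\<close>. Cotransposing these two along \<open>S\<close>, \<open>L\<close> gives the two
  sides of the second equation.\<close>

lemma comma_square_iff_span:
  assumes X: "X \<in> Obj B" and Y: "Y \<in> Obj D" and h: "h \<in> hom C (FObj F X) (FObj R Y)"
    and a: "a \<in> hom C (FObj F X) A" and b: "b \<in> hom C (FObj S Y) A"
  shows "(\<eta>LR A \<odot>\<^bsub>C\<^esub> \<epsilon>FG A) \<odot>\<^bsub>C\<^esub> FArr F (FArr G a \<odot>\<^bsub>B\<^esub> \<eta>FG X)
      = FArr R (FArr L b \<odot>\<^bsub>D\<^esub> \<eta>SL Y) \<odot>\<^bsub>C\<^esub> h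
    \<longleftrightarrow> a \<odot>\<^bsub>C\<^esub> \<epsilon>SL (FObj F X) = b \<odot>\<^bsub>C\<^esub> FArr S (\<epsilon>LR Y \<odot>\<^bsub>D\<^esub> FArr L h)"
proof -
  have A: "A \<in> Obj C" and FX: "FObj F X \<in> Obj C"
    using FG.counit.F.A.hom_objs[OF a] by simp_all
  define \<beta> where "\<beta> = FArr L b \<odot>\<^bsub>D\<^esub> \<eta>SL Y"
  define c where "c = \<epsilon>LR Y \<odot>\<^bsub>D\<^esub> FArr L h"
  have \<beta>: "\<beta> \<in> hom D Y (FObj L A)"
    unfolding \<beta>_def by (rule SL.transpose_in[OF Y b])
  have c: "c \<in> hom D (FObj L (FObj F X)) Y"
    unfolding c_def by (rule LR.cotranspose_in[OF Y h])
  have La: "FArr L a \<in> hom D (FObj L (FObj F X)) (FObj L A)"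
    by (rule LR.left.arr_in[OF a])
  \<comment> \<open>The counit cancels the transposition of \<open>a\<close>, and naturality of the
    unit then exhibits the result as the transpose of \<open>FArr L a\<close>.\<close>
  have "(\<eta>LR A \<odot>\<^bsub>C\<^esub> \<epsilon>FG A) \<odot>\<^bsub>C\<^esub> FArr F (FArr G a \<odot>\<^bsub>B\<^esub> \<eta>FG X) = \<eta>LR A \<odot>\<^bsub>C\<^esub> a"
    using FG.counit.F.A.comp_assoc[OF LR.unit_in[OF A] FG.counit_in[OF A]
        FG.left.arr_in[OF FG.transpose_in[OF X a]]] FG.cotranspose_transpose[OF X a] by simp
  also have "\<eta>LR A \<odot>\<^bsub>C\<^esub> a = FArr R (FArr L a) \<odot>\<^bsub>C\<^esub> \<eta>LR (FObj F X)"
    by (rule LR.unit_nat[OF a])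
  finally have lhs: "(\<eta>LR A \<odot>\<^bsub>C\<^esub> \<epsilon>FG A) \<odot>\<^bsub>C\<^esub> FArr F (FArr G a \<odot>\<^bsub>B\<^esub> \<eta>FG X)
      = FArr R (FArr L a) \<odot>\<^bsub>C\<^esub> \<eta>LR (FObj F X)" .
  have rhs: "FArr R \<beta> \<odot>\<^bsub>C\<^esub> h = FArr R (\<beta> \<odot>\<^bsub>D\<^esub> c) \<odot>\<^bsub>C\<^esub> \<eta>LR (FObj F X)"
    using LR.transpose_comp_right[OF FX c \<beta>] LR.transpose_cotranspose[OF Y h] by (simp add: c_def)
  have \<beta>c: "\<beta> \<odot>\<^bsub>D\<^esub> c \<in> hom D (FObj L (FObj F X)) (FObj L A)"
    by (rule LR.counit.F.A.comp_in[OF \<beta> c])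
  have "FArr R (FArr L a) \<odot>\<^bsub>C\<^esub> \<eta>LR (FObj F X) = FArr R (\<beta> \<odot>\<^bsub>D\<^esub> c) \<odot>\<^bsub>C\<^esub> \<eta>LR (FObj F X)
      \<longleftrightarrow> FArr L a = \<beta> \<odot>\<^bsub>D\<^esub> c"
    using LR.transpose_inj[OF FX La \<beta>c] by auto
  also have "\<dots> \<longleftrightarrow> \<epsilon>SL A \<odot>\<^bsub>C\<^esub> FArr S (FArr L a) = \<epsilon>SL A \<odot>\<^bsub>C\<^esub> FArr S (\<beta> \<odot>\<^bsub>D\<^esub> c)"
    using SL.cotranspose_inj[OF A La \<beta>c] by auto
  also have "\<dots> \<longleftrightarrow> a \<odot>\<^bsub>C\<^esub> \<epsilon>SL (FObj F X) = b \<odot>\<^bsub>C\<^esub> FArr S c"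
    using SL.counit_nat[OF a] SL.cotranspose_comp_left[OF A \<beta> c] SL.cotranspose_transpose[OF Y b]
    by (simp add: \<beta>_def)
  finally show ?thesis
    unfolding lhs \<beta>_def[symmetric] rhs c_def[symmetric] .
qed

lemma gamma_has_left_adjoint:
  assumes po: "has_pullbacks (op_cat C)"
  shows "has_left_adjoint C (comma B D C F R) \<gamma>"
proof (rule has_left_adjointI[OF gamma_functor])
  fix s assume s: "s \<in> Obj (comma B D C F R)"
  obtain X Y h where s_eq: "s = (X, Y, h)" by (cases s)
  have X: "X \<in> Obj B" and Y: "Y \<in> Obj D" and h: "h \<in> hom C (FObj F X) (FObj R Y)"
    using s by (simp_all add: s_eq comma_objs_iff)
  let ?FX = "FObj F X" and ?SY = "FObj S Y"
  have FX: "?FX \<in> Obj C"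
    by (rule FG.left.obj_in[OF X])
  \<comment> \<open>The span to be pushed out, with apex \<open>S (L (F X))\<close>;
    \<open>e\<close> and \<open>c\<close> are the arrows that \<open>comma_square_iff_span\<close>
    compares.\<close>
  define e where "e = \<epsilon>SL ?FX"
  define c where "c = FArr S (\<epsilon>LR Y \<odot>\<^bsub>D\<^esub> FArr L h)"
  have e: "e \<in> hom C (FObj S (FObj L ?FX)) ?FX"
    unfolding e_def by (rule SL.counit_in[OF FX])
  have c: "c \<in> hom C (FObj S (FObj L ?FX)) ?SY"
    unfolding c_def by (rule SL.left.arr_in[OF LR.cotranspose_in[OF Y h]])
  obtain P p q where po: "is_pullback (op_cat C) ?FX ?SY e c P p q"
    using po e c unfolding has_pullbacks_def by (metis hom_op_cat)
  then have p: "p \<in> hom C ?FX P" and q: "q \<in> hom C ?SY P" and pq: "p \<odot>\<^bsub>C\<^esub> e = q \<odot>\<^bsub>C\<^esub> c"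
    unfolding is_pullback_def by simp_all
  have P: "P \<in> Obj C"
    using FG.counit.F.A.hom_objs[OF p] by simp
  have iff: "(\<eta>LR A \<odot>\<^bsub>C\<^esub> \<epsilon>FG A) \<odot>\<^bsub>C\<^esub> FArr F (FArr G a \<odot>\<^bsub>B\<^esub> \<eta>FG X)
      = FArr R (FArr L b \<odot>\<^bsub>D\<^esub> \<eta>SL Y) \<odot>\<^bsub>C\<^esub> h \<longleftrightarrow> a \<odot>\<^bsub>C\<^esub> e = b \<odot>\<^bsub>C\<^esub> c"
    if "a \<in> hom C ?FX A" "b \<in> hom C ?SY A" for a b A
    unfolding e_def c_def by (rule comma_square_iff_span[OF X Y h that])
  \<comment> \<open>The universal arrow has as components the transposes of the two pushout
    coprojections; its square commutes because the pushout square does.\<close>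
  define u where "u = (s, FObj \<gamma> P, (FArr G p \<odot>\<^bsub>B\<^esub> \<eta>FG X, FArr L q \<odot>\<^bsub>D\<^esub> \<eta>SL Y))"
  have u: "u \<in> hom (comma B D C F R) s (FObj \<gamma> P)"
    using s gamma_FObj_in[OF P] unfolding u_def s_eq gamma_FObj
    by (intro hom_commaI) (simp_all add: FG.transpose_in[OF X p] SL.transpose_in[OF Y q] iff[OF p q] pq)
  have "\<exists>!d. d \<in> hom C P A \<and> FArr \<gamma> d \<odot>\<^bsub>comma B D C F R\<^esub> u = g"
    if A: "A \<in> Obj C" and g: "g \<in> hom (comma B D C F R) s (FObj \<gamma> A)" for A g
  proof -
    obtain a b where g_eq: "g = (s, FObj \<gamma> A, (a, b))"
      and a: "a \<in> hom B X (FObj G A)" and b: "b \<in> hom D Y (FObj L A)"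
      and sq: "(\<eta>LR A \<odot>\<^bsub>C\<^esub> \<epsilon>FG A) \<odot>\<^bsub>C\<^esub> FArr F a = FArr R b \<odot>\<^bsub>C\<^esub> h"
      using g unfolding gamma_FObj s_eq by (auto elim!: hom_commaE)
    define a' where "a' = \<epsilon>FG A \<odot>\<^bsub>C\<^esub> FArr F a"
    define b' where "b' = \<epsilon>SL A \<odot>\<^bsub>C\<^esub> FArr S b"
    have a': "a' \<in> hom C ?FX A" and b': "b' \<in> hom C ?SY A"
      unfolding a'_def b'_def by (rule FG.cotranspose_in[OF A a] SL.cotranspose_in[OF A b])+
    have a_eq: "FArr G a' \<odot>\<^bsub>B\<^esub> \<eta>FG X = a" and b_eq: "FArr L b' \<odot>\<^bsub>D\<^esub> \<eta>SL Y = b"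
      unfolding a'_def b'_def
      by (rule FG.transpose_cotranspose[OF A a] SL.transpose_cotranspose[OF A b])+
    \<comment> \<open>Composing with \<open>FArr \<gamma> d\<close> transposes to composing the
      coprojections with \<open>d\<close>. Factorisations of \<open>g\<close> through
      \<open>u\<close> are thus mediating arrows of the pushout.\<close>
    have eq_iff: "FArr \<gamma> d \<odot>\<^bsub>comma B D C F R\<^esub> u = g \<longleftrightarrow> d \<odot>\<^bsub>C\<^esub> p = a' \<and> d \<odot>\<^bsub>C\<^esub> q = b'"
      if d: "d \<in> hom C P A" for d
    proof -
      have dp: "d \<odot>\<^bsub>C\<^esub> p \<in> hom C ?FX A" and dq: "d \<odot>\<^bsub>C\<^esub> q \<in> hom C ?SY A"
        by (rule FG.counit.F.A.comp_in[OF d p] FG.counit.F.A.comp_in[OF d q])+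
      have "FArr \<gamma> d \<odot>\<^bsub>comma B D C F R\<^esub> u = g \<longleftrightarrow>
          FArr G (d \<odot>\<^bsub>C\<^esub> p) \<odot>\<^bsub>B\<^esub> \<eta>FG X = FArr G a' \<odot>\<^bsub>B\<^esub> \<eta>FG X \<and>
          FArr L (d \<odot>\<^bsub>C\<^esub> q) \<odot>\<^bsub>D\<^esub> \<eta>SL Y = FArr L b' \<odot>\<^bsub>D\<^esub> \<eta>SL Y"
        by (simp add: gamma_FArr[OF d] u_def g_eq FG.transpose_comp_right[OF X p d]
            SL.transpose_comp_right[OF Y q d] a_eq b_eq)
      also have "\<dots> \<longleftrightarrow> d \<odot>\<^bsub>C\<^esub> p = a' \<and> d \<odot>\<^bsub>C\<^esub> q = b'"
        using FG.transpose_inj[OF X dp a'] SL.transpose_inj[OF Y dq b'] by auto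
      finally show ?thesis .
    qed
    have "a' \<odot>\<^bsub>C\<^esub> e = b' \<odot>\<^bsub>C\<^esub> c"
      using iff[OF a' b'] sq by (simp add: a_eq b_eq)
    then have "\<exists>!d. d \<in> hom C P A \<and> d \<odot>\<^bsub>C\<^esub> p = a' \<and> d \<odot>\<^bsub>C\<^esub> q = b'"
      using po a' b' unfolding is_pullback_def by simp
    then show ?thesis
      by (simp add: eq_iff cong: conj_cong)
  qed
  with P u show "\<exists>A\<in>Obj C. \<exists>u\<in>hom (comma B D C F R) s (FObj \<gamma> A). \<forall>A'\<in>Obj C.
      \<forall>g\<in>hom (comma B D C F R) s (FObj \<gamma> A').
        \<exists>!d. d \<in> hom C A A' \<and> FArr \<gamma> d \<odot>\<^bsub>comma B D C F R\<^esub> u = g"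
    by (intro bexI[of _ P] bexI[of _ u]) simp_all
qed

end

theorem theorem2:
  fixes \<kappa> :: "'u rel"
    and B :: "('ob, 'ab) cat" and C :: "('oc, 'ac) cat" and D :: "('od, 'ad) cat"
    and F :: "('ob, 'ab, 'oc, 'ac) ftor" and G :: "('oc, 'ac, 'ob, 'ab) ftor"
    and L :: "('oc, 'ac, 'od, 'ad) ftor"
    and S R :: "('od, 'ad, 'oc, 'ac) ftor"
    and \<eta>FG :: "'ob \<Rightarrow> 'ab" and \<epsilon>FG :: "'oc \<Rightarrow> 'ac"
    and \<eta>SL :: "'od \<Rightarrow> 'ad" and \<epsilon>SL :: "'oc \<Rightarrow> 'ac"
    and \<eta>LR :: "'oc \<Rightarrow> 'ac" and \<epsilon>LR :: "'od \<Rightarrow> 'ad"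
  assumes size: "size_cardinal \<kappa>"
    and B: "category B" "locally_small \<kappa> B" "complete_cat \<kappa> B" "cocomplete_cat \<kappa> B"
    and C: "category C" "locally_small \<kappa> C" "complete_cat \<kappa> C" "cocomplete_cat \<kappa> C"
    and D: "category D" "locally_small \<kappa> D" "complete_cat \<kappa> D" "cocomplete_cat \<kappa> D"
    and cogen: "\<exists>Q. small \<kappa> Q \<and> cogenerating C Q"
    and wp: "well_powered \<kappa> C"
    and FG: "adjunction B C F G \<eta>FG \<epsilon>FG"
    and SL: "adjunction D C S L \<eta>SL \<epsilon>SL"
    and LR: "adjunction C D L R \<eta>LR \<epsilon>LR"
    and faithful: "faithful C G" "faithful C L"
    and conservative: "conservative C B G \<or> conservative C D L"
  shows "cat_isomorphism (comma B D C F R) (comma B D B id_ftor (comp_ftor G R))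
           (transpose_FG B G \<eta>FG)
       \<and> cat_isomorphism (comma B D C F R) (comma B D D (comp_ftor L F) id_ftor)
           (transpose_LR D L \<epsilon>LR)
       \<and> reflective_embedding C (comma B D C F R) (gamma C G L \<epsilon>FG \<eta>LR)"
proof (intro conjI)
  interpret adjoint_triple B C D F G L R \<eta>FG \<epsilon>FG \<eta>LR \<epsilon>LR S \<eta>SL \<epsilon>SL
    by (intro adjoint_triple.intro adjoint_pair.intro FG LR SL)
  have pb: "has_pullbacks C"
    by (rule complete_has_pullbacks[OF size C(1,3)])
  \<comment> \<open>Pushouts in \<open>C\<close>, as pullbacks in its opposite category, which is
    complete since \<open>C\<close> is cocomplete.\<close>
  have po: "has_pullbacks (op_cat C)"
    by (rule complete_has_pullbacks[OF size category_op_cat[OF C(1)] complete_cat_op_cat[OF C(4)]])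
  show "cat_isomorphism (comma B D C F R) (comma B D B id_ftor (comp_ftor G R)) (transpose_FG B G \<eta>FG)"
    by (rule transpose_FG_iso[OF FG functor_R])
  show "cat_isomorphism (comma B D C F R) (comma B D D (comp_ftor L F) id_ftor)
      (transpose_LR D L \<epsilon>LR)"
    by (rule transpose_LR_iso[OF LR functor_F])
  show "reflective_embedding C (comma B D C F R) \<gamma>"
    unfolding reflective_embedding_def
    using gamma_functor gamma_full[OF faithful conservative pb po] gamma_faithful[OF faithful(1)]
      gamma_has_left_adjoint[OF po] by blast
qed

end
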